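(* Let $\boldsymbol d=\boldsymbol d(n)$ be a graphical degree sequence of length $n$ with all entries positive and even, such that $\log^8 n=o(d_{\mathrm{max}})$ and $d_{\mathrm{min}}\ge\gamma d_{\mathrm{max}}$ for some fixed constant $\gamma>0$. Let $G\sim\mathcal G(n,\boldsymbol d)$. Then, with probability at least $1-e^{-\Omega(d_{\mathrm{max}}^2)}$, \[ \rho(G)=\widehat\rho(G)+O\Bigl(\frac{\log^2d_{\mathrm{max}}}{d_{\mathrm{max}}}\Bigr). \]
   Context: $\mathcal G(n,\boldsymbol d)$ is the uniform probability space of simple graphs on vertex set $\{1,\ldots,n\}$ with degree sequence $\boldsymbol d$; $d_{\mathrm{min}},d_{\mathrm{max}}$ are the minimum and maximum of $\boldsymbol d$. For such $G$, $\operatorname{EO}(G)$ is the number of orientations of the edges such that every vertex has in-degree equal to out-degree; $\rho(G):=\frac1n\log\operatorname{EO}(G)$ and $\widehat\rho(G):=\frac1n\sum_{i=1}^n\bigl(\log\binom{d_i}{d_i/2}-\frac{d_i}{2}\log 2\bigr)$. Asymptotics are as $n\to\infty$. *)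

theory Defs
  imports "HOL-Probability.Probability" "HOL-Library.Ramsey" "HOL-Library.Landau_Symbols"
begin

text \<open>
  A simple graph on the vertex set \<open>{1..n}\<close> is given by its edge set \<open>E \<subseteq> nsets {1..n} 2\<close>,
  where \<open>nsets V 2\<close> consists of the two-element subsets of \<open>V\<close>.  A degree sequence of length \<open>n\<close>
  is a function \<open>d\<close> of which only the values on \<open>{1..n}\<close> matter.
\<close>

definition degree :: "nat set set \<Rightarrow> nat \<Rightarrow> nat" where
  "degree E v = card {e \<in> E. v \<in> e}"

definition graphs_with_degrees :: "nat \<Rightarrow> (nat \<Rightarrow> nat) \<Rightarrow> nat set set set" where
  "graphs_with_degrees n d = {E. E \<subseteq> nsets {1..n} 2 \<and> (\<forall>v\<in>{1..n}. degree E v = d v)}"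

definition graphical :: "nat \<Rightarrow> (nat \<Rightarrow> nat) \<Rightarrow> bool" where
  "graphical n d \<longleftrightarrow> graphs_with_degrees n d \<noteq> {}"

lemma finite_graphs_with_degrees: "finite (graphs_with_degrees n d)"
  by (rule finite_subset[of _ "Pow (nsets {1..n} 2)"])
     (auto simp: graphs_with_degrees_def finite_imp_finite_nsets)

text \<open>Since \<open>graphs_with_degrees n d\<close> is finite, the following is the uniform distribution on it
  whenever \<open>graphical n d\<close> holds.\<close>

definition random_graph :: "nat \<Rightarrow> (nat \<Rightarrow> nat) \<Rightarrow> nat set set pmf" where
  "random_graph n d = pmf_of_set (graphs_with_degrees n d)"

definition d_max :: "nat \<Rightarrow> (nat \<Rightarrow> nat) \<Rightarrow> nat" where
  "d_max n d = Max (d ` {1..n})"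

definition d_min :: "nat \<Rightarrow> (nat \<Rightarrow> nat) \<Rightarrow> nat" where
  "d_min n d = Min (d ` {1..n})"

text \<open>An orientation of \<open>E\<close> is a set of arcs \<open>(tail, head)\<close> containing, for each edge
  \<open>{u, v} \<in> E\<close>, exactly one of \<open>(u, v)\<close> and \<open>(v, u)\<close>, and no other arcs.\<close>

definition is_orientation :: "nat set set \<Rightarrow> (nat \<times> nat) set \<Rightarrow> bool" where
  "is_orientation E A \<longleftrightarrow> bij_betw (\<lambda>(u, v). {u, v}) A E"

definition eulerian_orientations :: "nat \<Rightarrow> nat set set \<Rightarrow> (nat \<times> nat) set set" where
  "eulerian_orientations n E =
     {A. is_orientation E A \<and> (\<forall>v\<in>{1..n}. card {u. (u, v) \<in> A} = card {w. (v, w) \<in> A})}"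

lemma finite_eulerian_orientations:
  assumes "E \<subseteq> nsets {1..n} 2"
  shows "finite (eulerian_orientations n E)"
proof (rule finite_subset)
  show "eulerian_orientations n E \<subseteq> Pow ({1..n} \<times> {1..n})"
  proof (clarsimp simp: eulerian_orientations_def is_orientation_def)
    fix A u v
    assume "bij_betw (\<lambda>(u, v). {u, v}) A E" and "(u, v) \<in> A"
    then have "{u, v} \<in> E"
      by (force dest: bij_betw_imp_surj_on)
    with assms have "{u, v} \<subseteq> {1..n}"
      by (auto simp: nsets_def)
    then show "Suc 0 \<le> u \<and> u \<le> n \<and> Suc 0 \<le> v \<and> v \<le> n"
      by auto
  qed
qed simp

definition EO :: "nat \<Rightarrow> nat set set \<Rightarrow> nat" where
  "EO n E = card (eulerian_orientations n E)"

definition rho :: "nat \<Rightarrow> nat set set \<Rightarrow> real" where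
  "rho n E = 1 / real n * ln (real (EO n E))"

definition rho_hat :: "nat \<Rightarrow> nat set set \<Rightarrow> real" where
  "rho_hat n E =
     1 / real n * (\<Sum>i=1..n. ln (real (degree E i choose (degree E i div 2)))
                           - real (degree E i) / 2 * ln 2)"

end

theory Submission
  imports Defs
begin

text \<open>
  The estimate holds for every graph with these degrees as soon as \<open>d_max\<close> is large, so the
  probability is eventually one. Write \<open>EO(G) / 2^|E|\<close> as the integral of
  \<open>\<Prod> cos (\<theta>\<^sub>u - \<theta>\<^sub>v)\<close> over uniform angles in \<open>[-\<pi>/2, \<pi>/2]\<close>.

  Lower bound: expanding the cosines gives only nonnegative terms, one of which is Pauling's estimate.

  Upper bound: drop the balance condition on a set \<open>S\<close> of \<open>O(n log d / d)\<close> vertices such that every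
  other vertex has at least \<open>k = K log d\<close> neighbours in \<open>S\<close>; this pins the angles on \<open>S\<close> to \<open>0\<close> and
  costs a factor \<open>d^|S| = exp (O(n log\<^sup>2 d / d))\<close>. A vertex with \<open>|\<theta>| > \<pi>/4\<close> costs a factor \<open>2^(-k/2)\<close>,
  which beats the polynomial factors in \<open>d\<close> lost by deleting it. On the remaining vertices
  \<open>cos x \<le> exp (- x\<^sup>2 / 2)\<close>, and the Gaussian integral is evaluated one variable at a time. The pivot at
  \<open>v\<close> is the effective conductance from \<open>v\<close> to the variables not yet integrated, which by the series
  law is at least the degree of \<open>v\<close> minus \<open>\<Sum> 1 / (1 + p\<^sub>u)\<close>, summed over the neighbours \<open>u\<close> already
  integrated, where \<open>p\<^sub>u\<close> counts the neighbours of \<open>u\<close> not yet integrated. In any order these losses add up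
  to at most a harmonic sum per vertex \<open>u\<close>.
\<close>

section \<open>Elementary estimates\<close>

text \<open>The product \<open>cos x * exp (x\<^sup>2 / 2)\<close> is 1 at 0 and nonincreasing on
  [0, pi/2]: its derivative is a nonnegative multiple of \<open>x * cos x - sin x\<close>, and
  \<open>sin t - t * cos t\<close> has derivative \<open>t * sin t\<close>.\<close>

lemma cos_le_exp_neg_half_square:
  fixes x :: real
  assumes "\<bar>x\<bar> \<le> pi / 2"
  shows "cos x \<le> exp (- x\<^sup>2 / 2)"
proof -
  have *: "cos x \<le> exp (- x\<^sup>2 / 2)" if x: "0 \<le> x" "x \<le> pi / 2" for x :: real
  proof -
    have sin_ge: "t * cos t \<le> sin t" if t: "0 \<le> t" "t \<le> pi / 2" for t :: real
    proof -
      have "sin 0 - 0 * cos 0 \<le> sin t - t * cos t"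
      proof (rule DERIV_nonneg_imp_nondecreasing[OF t(1)])
        fix y assume y: "0 \<le> y" "y \<le> t"
        have "((\<lambda>t. sin t - t * cos t) has_real_derivative y * sin y) (at y)"
          by (auto intro!: derivative_eq_intros simp: algebra_simps)
        moreover have "0 \<le> y * sin y"
          using y t by (intro mult_nonneg_nonneg sin_ge_zero) auto
        ultimately show "\<exists>z. ((\<lambda>t. sin t - t * cos t) has_real_derivative z) (at y) \<and> 0 \<le> z"
          by blast
      qed
      then show ?thesis by simp
    qed
    have "cos x * exp (x\<^sup>2 / 2) \<le> cos 0 * exp (0\<^sup>2 / 2)"
    proof (rule DERIV_nonpos_imp_nonincreasing[OF x(1)])
      fix y assume y: "0 \<le> y" "y \<le> x"
      have "((\<lambda>x. cos x * exp (x\<^sup>2 / 2)) has_real_derivative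
              (y * cos y - sin y) * exp (y\<^sup>2 / 2)) (at y)"
        by (auto intro!: derivative_eq_intros simp: algebra_simps)
      moreover have "(y * cos y - sin y) * exp (y\<^sup>2 / 2) \<le> 0"
        using sin_ge[of y] y x by (intro mult_nonpos_nonneg) auto
      ultimately show "\<exists>z. ((\<lambda>x. cos x * exp (x\<^sup>2 / 2)) has_real_derivative z) (at y) \<and> z \<le> 0"
        by blast
    qed
    then show ?thesis
      by (simp add: exp_minus field_simps)
  qed
  show ?thesis
    using *[of "\<bar>x\<bar>"] assms by simp
qed

text \<open>Used for an edge from a pinned vertex to a vertex with angle beyond pi/4: each such edge
  costs a factor sqrt 2.\<close>

lemma cos_le_inverse_sqrt2:
  fixes x :: real
  assumes "pi / 4 \<le> \<bar>x\<bar>" "\<bar>x\<bar> \<le> pi / 2"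
  shows "\<bar>cos x\<bar> \<le> 1 / sqrt 2"
proof -
  have "cos \<bar>x\<bar> \<le> cos (pi / 4)"
    using assms by (intro cos_monotone_0_pi_le) auto
  moreover have "cos (pi / 4) = 1 / sqrt 2"
    by (simp add: cos_45 real_div_sqrt eq_divide_eq)
  moreover have "0 \<le> cos \<bar>x\<bar>"
    using assms by (intro cos_ge_zero) auto
  ultimately show ?thesis
    by simp
qed

lemma harm_le_one_plus_ln: "harm n \<le> 1 + ln (real n)" if "n > 0"
  using euler_mascheroni_sequence_decreasing[of 1 n] that by (simp add: harm_def)

text \<open>Listed from the largest element down, the terms are 1, 1/2, 1/3, ...; adding a new
  minimum appends the next one.\<close>

lemma sum_inverse_rank_le_harm:
  fixes J :: "'a::linorder set"
  assumes "finite J"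
  shows "(\<Sum>j\<in>J. 1 / (1 + real (card {i\<in>J. j < i}))) \<le> harm (card J)"
  using assms
proof (induction rule: finite_linorder_min_induct)
  case empty
  then show ?case by (simp add: harm_def)
next
  case (insert b A)
  have b: "b \<notin> A" using insert by auto
  have 1: "{i \<in> insert b A. b < i} = A" using insert by auto
  have 2: "{i \<in> insert b A. j < i} = {i \<in> A. j < i}" if "j \<in> A" for j
    using insert that by auto
  have "(\<Sum>j\<in>insert b A. 1 / (1 + real (card {i\<in>insert b A. j < i})))
      = 1 / (1 + real (card A)) + (\<Sum>j\<in>A. 1 / (1 + real (card {i\<in>A. j < i})))"
    using b insert(1) 1 2 by simp
  also have "\<dots> \<le> 1 / (1 + real (card A)) + harm (card A)"
    using insert.IH by simp
  also have "\<dots> = harm (card (insert b A))"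
    using b insert(1) by (simp add: harm_Suc inverse_eq_divide add.commute)
  finally show ?case .
qed

section \<open>Central binomial coefficients through the Wallis product\<close>

lemma central_binomial_recurrence:
  fixes c :: "nat \<Rightarrow> real"
  defines "c \<equiv> \<lambda>n. real ((2 * n) choose n) / 4 ^ n"
  shows "c (Suc n) = c n * (2 * real n + 1) / (2 * real n + 2)"
proof -
  define F f :: real where "F = fact (2 * n)" and "f = fact n"
  have pos: "f > 0" unfolding f_def by simp
  have b: "real ((2 * m) choose m) = fact (2 * m) / (fact m * fact m)" for m
    using binomial_fact[of m "2 * m", where 'a = real] by simp
  have 1: "fact (2 * Suc n) = (2 * real n + 2) * (2 * real n + 1) * F"
    unfolding F_def by (simp add: algebra_simps)
  have 2: "fact (Suc n) = (real n + 1) * f"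
    unfolding f_def by (simp add: algebra_simps)
  define x q :: real where "x = real n + 1" and "q = 4 ^ n"
  have "x \<noteq> 0" "q \<noteq> 0" "f \<noteq> 0" and 3: "2 * real n + 2 = 2 * x" "2 * real n + 1 = 2 * x - 1"
    using pos unfolding x_def q_def by auto
  then show ?thesis
    unfolding c_def b 1 2 F_def[symmetric] f_def[symmetric] power_Suc 3 x_def[symmetric] q_def[symmetric]
    by (simp add: field_simps)
qed

text \<open>The factor at k is the square of 2k over (2k - 1)(2k + 1), so the product telescopes
  against \<open>central_binomial_recurrence\<close>.\<close>

lemma wallis_product_central_binomial:
  "(\<Prod>k=1..n. (4 * real k ^ 2) / (4 * real k ^ 2 - 1))
     = 1 / ((real ((2 * n) choose n) / 4 ^ n) ^ 2 * (2 * real n + 1))"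
proof (induction n)
  case 0
  then show ?case by simp
next
  case (Suc n)
  define c where "c = real ((2 * n) choose n) / 4 ^ n"
  have c: "real ((2 * Suc n) choose (Suc n)) / 4 ^ Suc n = c * (2 * real n + 1) / (2 * real n + 2)"
    unfolding c_def by (rule central_binomial_recurrence)
  have "c > 0" unfolding c_def by simp
  have f: "4 * real (Suc n) ^ 2 - 1 = (2 * real n + 1) * (2 * real n + 3)"
    by (simp add: power2_eq_square algebra_simps)
  have "(\<Prod>k=1..Suc n. (4 * real k ^ 2) / (4 * real k ^ 2 - 1))
     = 1 / (c ^ 2 * (2 * real n + 1)) * ((2 * real n + 2)\<^sup>2 / ((2 * real n + 1) * (2 * real n + 3)))"
    using Suc unfolding c_def[symmetric]
    by (simp only: prod.atLeast_Suc_atMost_Suc_shift prod.nat_ivl_Suc' f) (simp add: f power2_eq_square algebra_simps)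
  also have "\<dots> = 1 / ((c * (2 * real n + 1) / (2 * real n + 2)) ^ 2 * (2 * real (Suc n) + 1))"
    using \<open>c > 0\<close> by (simp add: field_simps power2_eq_square)
  finally show ?case unfolding c .
qed

text \<open>The partial Wallis products increase to pi/2; bounding one of them by the limit and
  solving for the binomial gives this. It serves to exchange Gaussian factors for exact
  probabilities of balance.\<close>

lemma central_binomial_lower:
  "real ((2 * n) choose n) / 4 ^ n \<ge> 1 / sqrt (pi * (real n + 1 / 2))"
proof -
  define w where "w = (\<lambda>n. \<Prod>k=1..n. (4 * real k ^ 2) / (4 * real k ^ 2 - 1))"
  have "incseq w"
  proof (rule incseq_SucI)
    fix n
    have "1 \<le> (4 * real (Suc n) ^ 2) / (4 * real (Suc n) ^ 2 - 1)"
      by (subst le_divide_eq_1_pos) (auto simp: power2_eq_square algebra_simps add_pos_nonneg)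
    moreover have "w n \<ge> 0"
      unfolding w_def wallis_product_central_binomial by simp
    moreover have "w (Suc n) = w n * ((4 * real (Suc n) ^ 2) / (4 * real (Suc n) ^ 2 - 1))"
      unfolding w_def by (subst prod.nat_ivl_Suc') auto
    ultimately show "w n \<le> w (Suc n)"
      by (metis mult.right_neutral mult_left_mono)
  qed
  then have "w n \<le> pi / 2"
    using wallis unfolding w_def[symmetric] by (rule incseq_le)
  define C where "C = (real ((2 * n) choose n) / 4 ^ n) ^ 2"
  have C: "C > 0" "C * (2 * real n + 1) > 0" "pi * (real n + 1 / 2) > 0"
    unfolding C_def by (auto intro!: mult_pos_pos add_nonneg_pos)
  have "1 / (C * (2 * real n + 1)) \<le> pi / 2"
    using \<open>w n \<le> pi / 2\<close> unfolding w_def wallis_product_central_binomial C_def .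
  then have "1 \<le> pi / 2 * (C * (2 * real n + 1))"
    using C(2) by (simp only: pos_divide_le_eq)
  also have "\<dots> = C * (pi * (real n + 1 / 2))"
    by (simp add: algebra_simps)
  finally have "1 / (pi * (real n + 1 / 2)) \<le> (real ((2 * n) choose n) / 4 ^ n) ^ 2"
    using C(3) by (simp only: pos_divide_le_eq C_def)
  then have "sqrt (1 / (pi * (real n + 1 / 2))) \<le> real ((2 * n) choose n) / 4 ^ n"
    by (intro real_le_lsqrt) auto
  then show ?thesis by (simp add: real_sqrt_divide)
qed

section \<open>Gaussian integrals over angles\<close>

text \<open>An interval of length pi, not 2 pi, suffices because even degrees allow only even
  frequencies. Cosine is nonnegative on it, which the lower bound needs.\<close>

definition angle_measure :: "real measure" where
  "angle_measure = uniform_measure lborel {- pi / 2..pi / 2}"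

lemma sets_angle_measure [measurable_cong, simp]: "sets angle_measure = sets borel"
  by (simp add: angle_measure_def)

lemma space_angle_measure [simp]: "space angle_measure = UNIV"
  by (simp add: angle_measure_def)

interpretation angle: prob_space angle_measure
  unfolding angle_measure_def by (rule prob_space_uniform_measure) auto

interpretation angles: product_prob_space "\<lambda>_. angle_measure" UNIV
  by unfold_locales

lemma AE_angle_measure: "AE x in angle_measure. \<bar>x\<bar> \<le> pi / 2"
  unfolding angle_measure_def by (rule AE_uniform_measureI) auto

lemma AE_angles:
  assumes "finite U"
  shows "AE x in Pi\<^sub>M U (\<lambda>_. angle_measure). \<forall>i\<in>U. \<bar>x i\<bar> \<le> pi / 2"
  using assms
proof (rule AE_finite_allI)
  fix i assume "i \<in> U"
  then show "AE x in Pi\<^sub>M U (\<lambda>_. angle_measure). \<bar>x i\<bar> \<le> pi / 2"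
    by (intro AE_PiM_component[OF angle.prob_space_axioms _ AE_angle_measure])
qed

text \<open>The integral is enlarged to the whole line, where the integrand is a multiple of the
  normal density with mean \<open>- c\<close> and variance \<open>1 / a\<close>; the constant arises
  as \<open>sqrt (2 * pi / a) / pi\<close>.\<close>

lemma gaussian_angle_integral_le:
  assumes "a > 0"
  shows "(\<integral>\<^sup>+t. ennreal (exp (- a * (t + c)\<^sup>2 / 2)) \<partial>angle_measure) \<le> ennreal (sqrt (2 / (pi * a)))"
proof -
  define \<sigma> where "\<sigma> = 1 / sqrt a"
  have \<sigma>: "\<sigma> > 0" "\<sigma>\<^sup>2 = 1 / a" using assms by (auto simp: \<sigma>_def power_divide)
  have nd: "exp (- a * (t + c)\<^sup>2 / 2) = sqrt (2 * pi / a) * normal_density (- c) \<sigma> t" for t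
  proof -
    have "- a * (t + c)\<^sup>2 / 2 = - (t - - c)\<^sup>2 / (2 * \<sigma>\<^sup>2)"
      using assms by (simp add: \<sigma>(2))
    moreover have "sqrt (2 * pi / a) * (1 / sqrt (2 * pi * \<sigma>\<^sup>2)) = 1"
      using assms by (simp add: \<sigma>(2))
    ultimately show ?thesis
      using assms by (simp add: normal_density_def)
  qed
  have "(\<integral>\<^sup>+t. ennreal (exp (- a * (t + c)\<^sup>2 / 2)) \<partial>angle_measure)
      = (\<integral>\<^sup>+t. ennreal (exp (- a * (t + c)\<^sup>2 / 2)) * indicator {- pi / 2..pi / 2} t \<partial>lborel) / ennreal pi"
    unfolding angle_measure_def by (subst nn_integral_uniform_measure) auto
  also have "\<dots> \<le> (\<integral>\<^sup>+t. ennreal (exp (- a * (t + c)\<^sup>2 / 2)) \<partial>lborel) / ennreal pi"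
    by (intro divide_right_mono_ennreal nn_integral_mono) (auto split: split_indicator)
  also have "(\<integral>\<^sup>+t. ennreal (exp (- a * (t + c)\<^sup>2 / 2)) \<partial>lborel)
      = ennreal (sqrt (2 * pi / a)) * (\<integral>\<^sup>+t. ennreal (normal_density (- c) \<sigma> t) \<partial>lborel)"
    unfolding nd using assms by (subst nn_integral_cmult[symmetric]) (auto simp: ennreal_mult)
  also have "(\<integral>\<^sup>+t. ennreal (normal_density (- c) \<sigma> t) \<partial>lborel) = 1"
    using \<sigma>(1) by (subst nn_integral_eq_integral) auto
  also have "ennreal (sqrt (2 * pi / a)) * 1 / ennreal pi = ennreal (sqrt (2 * pi / a) / pi)"
    using assms by (simp add: divide_ennreal)
  also have "sqrt (2 * pi / a) / pi = sqrt (2 / (pi * a))"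
  proof -
    have "sqrt (2 * pi / a) / pi = sqrt (2 * pi / a) / sqrt (pi\<^sup>2)" by simp
    also have "\<dots> = sqrt (2 / (pi * a))"
      unfolding real_sqrt_divide[symmetric] by (simp add: power2_eq_square)
    finally show ?thesis .
  qed
  finally show ?thesis .
qed

text \<open>Integrating out one variable replaces the form by its Schur complement, whose value at a point
  is the value of the original form at some extension of that point; this is why a lower bound for
  the form on vectors supported on the variables up to \<open>v\<close> bounds the pivot at \<open>v\<close>.\<close>

lemma gaussian_angles_integral_le:
  fixes q :: "'a::linorder \<Rightarrow> 'a \<Rightarrow> real" and \<alpha> :: "'a \<Rightarrow> real"
  assumes "finite A" "finite U" "A \<subseteq> U"
    and "\<And>i j. q i j = q j i"
    and "\<And>x. 0 \<le> (\<Sum>i\<in>U. \<Sum>j\<in>U. q i j * x i * x j)"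
    and "\<And>v. v \<in> A \<Longrightarrow> \<alpha> v > 0"
    and "\<And>v x. v \<in> A \<Longrightarrow> x v = 1 \<Longrightarrow> (\<And>w. w \<in> U \<Longrightarrow> \<not> (w \<in> A \<and> w \<le> v) \<Longrightarrow> x w = 0)
           \<Longrightarrow> \<alpha> v \<le> (\<Sum>i\<in>U. \<Sum>j\<in>U. q i j * x i * x j)"
  shows "(\<integral>\<^sup>+x. ennreal (exp (- (\<Sum>i\<in>U. \<Sum>j\<in>U. q i j * x i * x j) / 2)) \<partial>Pi\<^sub>M U (\<lambda>_. angle_measure))
           \<le> ennreal (\<Prod>v\<in>A. sqrt (2 / (pi * \<alpha> v)))"
  using assms
proof (induction arbitrary: U q rule: finite_linorder_min_induct)
  case empty
  \<comment> \<open>With no variable left to integrate exactly, nonnegativity of the form bounds the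
    integrand by 1; this disposes of the variables outside \<open>A\<close>.\<close>
  interpret P: prob_space "Pi\<^sub>M U (\<lambda>_. angle_measure)"
    by (rule prob_space_PiM) (rule angle.prob_space_axioms)
  have "(\<integral>\<^sup>+x. ennreal (exp (- (\<Sum>i\<in>U. \<Sum>j\<in>U. q i j * x i * x j) / 2)) \<partial>Pi\<^sub>M U (\<lambda>_. angle_measure))
      \<le> (\<integral>\<^sup>+x. 1 \<partial>Pi\<^sub>M U (\<lambda>_. angle_measure))"
    using empty by (intro nn_integral_mono) auto
  then show ?case by (simp add: P.emeasure_space_1)
next
  case (insert v A U q)
  define Q where "Q x = (\<Sum>i\<in>U. \<Sum>j\<in>U. q i j * x i * x j)" for x
  define U' where "U' = U - {v}"
  have U: "U = insert v U'" "v \<notin> U'" "finite U'" using insert.prems by (auto simp: U'_def)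
  define a where "a = q v v"
  define b where "b x = (\<Sum>j\<in>U'. q v j * x j)" for x
  define R where "R x = (\<Sum>i\<in>U'. \<Sum>j\<in>U'. q i j * x i * x j)" for x
  \<comment> \<open>The Schur complement of the entry at v.\<close>
  define q' where "q' i j = q i j - q i v * q v j / a" for i j
  define Q' where "Q' x = (\<Sum>i\<in>U'. \<Sum>j\<in>U'. q' i j * x i * x j)" for x
  have split: "Q (x(v := t)) = a * t\<^sup>2 + 2 * t * b x + R x" for x t
  proof -
    have ne: "j \<noteq> v" if "j \<in> U'" for j using that U by auto
    have "Q (x(v := t)) = a * t * t + (\<Sum>j\<in>U'. q v j * t * x j)
        + (\<Sum>i\<in>U'. q i v * x i * t + (\<Sum>j\<in>U'. q i j * x i * x j))"
      unfolding Q_def U(1) using U(2,3) ne by (simp add: a_def cong: sum.cong)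
    also have "(\<Sum>j\<in>U'. q v j * t * x j) = t * b x"
      by (simp add: b_def sum_distrib_left algebra_simps)
    also have "(\<Sum>i\<in>U'. q i v * x i * t + (\<Sum>j\<in>U'. q i j * x i * x j)) = t * b x + R x"
      using insert.prems(3) by (simp add: b_def R_def sum.distrib sum_distrib_left algebra_simps)
    finally show ?thesis by (simp add: fun_upd_def power2_eq_square algebra_simps)
  qed
  have Q'_eq: "Q' x = R x - (b x)\<^sup>2 / a" for x
  proof -
    have "(b x)\<^sup>2 / a = (\<Sum>i\<in>U'. \<Sum>j\<in>U'. q i v * q v j / a * x i * x j)"
      unfolding power2_eq_square b_def sum_product sum_divide_distrib
      using insert.prems(3) by (intro sum.cong refl) (simp add: algebra_simps)
    then show ?thesis
      by (simp add: Q'_def R_def q'_def sum_subtractf algebra_simps)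
  qed
  \<comment> \<open>The unit vector at v is an admissible test vector, so the diagonal entry is at
    least \<open>\<alpha> v\<close>.\<close>
  have "\<alpha> v \<le> Q (\<lambda>i. if i = v then 1 else 0)"
    unfolding Q_def by (rule insert.prems(6)) auto
  also have "\<dots> = a"
    using split[of "\<lambda>_. 0" 1] by (simp add: fun_upd_def b_def R_def)
  finally have a: "\<alpha> v \<le> a" .
  have "a > 0" using a insert.prems(5)[of v] by simp
  \<comment> \<open>The coordinate \<open>- b x / a\<close> minimises the form in the direction of
    v, and the minimum is the Schur complement.\<close>
  have Q'_ext: "Q' x = Q (x(v := - b x / a))" for x
    unfolding split Q'_eq using \<open>a > 0\<close> by (simp add: field_simps power2_eq_square)
  have sq: "Q (x(v := t)) = a * (t + b x / a)\<^sup>2 + Q' x" for x t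
    unfolding split Q'_eq using \<open>a > 0\<close> by (simp add: field_simps power2_eq_square)
  have IH: "(\<integral>\<^sup>+x. ennreal (exp (- Q' x / 2)) \<partial>Pi\<^sub>M U' (\<lambda>_. angle_measure))
      \<le> ennreal (\<Prod>v\<in>A. sqrt (2 / (pi * \<alpha> v)))"
    unfolding Q'_def
  proof (rule insert.IH)
    show "finite U'" "A \<subseteq> U'" using insert U by auto
    show "q' i j = q' j i" for i j
      using insert.prems(3) by (simp add: q'_def)
    show "0 \<le> (\<Sum>i\<in>U'. \<Sum>j\<in>U'. q' i j * x i * x j)" for x
      using insert.prems(4) unfolding Q'_def[symmetric] Q'_ext by (simp add: Q_def)
    show "0 < \<alpha> w" if "w \<in> A" for w using insert.prems(5) that by auto
    show "\<alpha> w \<le> (\<Sum>i\<in>U'. \<Sum>j\<in>U'. q' i j * x i * x j)"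
      if w: "w \<in> A" and x: "x w = 1" "\<And>u. u \<in> U' \<Longrightarrow> \<not> (u \<in> A \<and> u \<le> w) \<Longrightarrow> x u = 0" for w x
      unfolding Q'_def[symmetric] Q'_ext unfolding Q_def
    proof (rule insert.prems(6))
      \<comment> \<open>The extension changes only the coordinate v, which precedes w, so a test
        vector for the smaller form stays one for the larger form.\<close>
      have "v < w" using w insert by auto
      then show "(x(v := - b x / a)) w = 1" using x by auto
      show "(x(v := - b x / a)) u = 0" if "u \<in> U" "\<not> (u \<in> insert v A \<and> u \<le> w)" for u
        using that x \<open>v < w\<close> by (auto simp: U'_def)
    qed (use w in auto)
  qed
  have meas: "Q \<in> borel_measurable (Pi\<^sub>M (insert v U') (\<lambda>_. angle_measure))"
    unfolding Q_def U(1) by measurable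
  have "(\<integral>\<^sup>+x. ennreal (exp (- Q x / 2)) \<partial>Pi\<^sub>M U (\<lambda>_. angle_measure))
      = (\<integral>\<^sup>+x. \<integral>\<^sup>+t. ennreal (exp (- Q (x(v := t)) / 2)) \<partial>angle_measure \<partial>Pi\<^sub>M U' (\<lambda>_. angle_measure))"
    unfolding U(1) using U meas by (subst angles.product_nn_integral_insert) auto
  also have "\<dots> = (\<integral>\<^sup>+x. ennreal (exp (- Q' x / 2)) *
      (\<integral>\<^sup>+t. ennreal (exp (- a * (t + b x / a)\<^sup>2 / 2)) \<partial>angle_measure) \<partial>Pi\<^sub>M U' (\<lambda>_. angle_measure))"
    by (subst nn_integral_cmult[symmetric])
       (auto simp: sq ennreal_mult[symmetric] exp_add[symmetric] diff_divide_distrib algebra_simps)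
  also have "\<dots> \<le> (\<integral>\<^sup>+x. ennreal (exp (- Q' x / 2)) * ennreal (sqrt (2 / (pi * \<alpha> v)))
      \<partial>Pi\<^sub>M U' (\<lambda>_. angle_measure))"
  proof (intro nn_integral_mono mult_left_mono)
    fix x
    have "(\<integral>\<^sup>+t. ennreal (exp (- a * (t + b x / a)\<^sup>2 / 2)) \<partial>angle_measure) \<le> ennreal (sqrt (2 / (pi * a)))"
      using \<open>a > 0\<close> by (rule gaussian_angle_integral_le)
    also have "\<dots> \<le> ennreal (sqrt (2 / (pi * \<alpha> v)))"
      using a insert.prems(5)[of v] \<open>a > 0\<close>
      by (intro ennreal_leI real_sqrt_le_mono divide_left_mono mult_left_mono mult_pos_pos) auto
    finally show "(\<integral>\<^sup>+t. ennreal (exp (- a * (t + b x / a)\<^sup>2 / 2)) \<partial>angle_measure)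
        \<le> ennreal (sqrt (2 / (pi * \<alpha> v)))" .
  qed auto
  also have "\<dots> = (\<integral>\<^sup>+x. ennreal (exp (- Q' x / 2)) \<partial>Pi\<^sub>M U' (\<lambda>_. angle_measure)) * ennreal (sqrt (2 / (pi * \<alpha> v)))"
    unfolding Q'_def by (rule nn_integral_multc) measurable
  also have "\<dots> \<le> ennreal (\<Prod>v\<in>A. sqrt (2 / (pi * \<alpha> v))) * ennreal (sqrt (2 / (pi * \<alpha> v)))"
    by (intro mult_right_mono IH) auto
  also have "\<dots> = ennreal (\<Prod>v\<in>insert v A. sqrt (2 / (pi * \<alpha> v)))"
  proof -
    have "0 \<le> (\<Prod>v\<in>A. sqrt (2 / (pi * \<alpha> v)))" "0 \<le> sqrt (2 / (pi * \<alpha> v))"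
      using insert.prems(5) by (auto intro!: prod_nonneg simp: less_imp_le)
    moreover have "v \<notin> A" using insert by auto
    ultimately show ?thesis
      using insert(1) by (simp add: ennreal_mult[symmetric] mult.commute)
  qed
  finally show ?case unfolding Q_def .
qed

section \<open>Orientations\<close>

lemma lebesgue_integral_angle_measure:
  fixes f :: "real \<Rightarrow> 'b::{banach, second_countable_topology}"
  assumes [measurable]: "f \<in> borel_measurable borel"
  shows "(LINT t|angle_measure. f t) = (1 / pi) *\<^sub>R (LINT t|lborel. indicator {- pi / 2..pi / 2} t *\<^sub>R f t)"
proof -
  have "angle_measure = density lborel (\<lambda>t. ennreal (indicator {- pi / 2..pi / 2} t / pi))"
    unfolding angle_measure_def uniform_measure_def using divide_ennreal[of 1 pi]
    by (intro density_cong) (auto split: split_indicator)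
  then have "(LINT t|angle_measure. f t) = integral\<^sup>L (density lborel (\<lambda>t. ennreal (indicator {- pi / 2..pi / 2} t / pi))) f"
    by simp
  also have "\<dots> = (LINT t|lborel. (indicator {- pi / 2..pi / 2} t / pi) *\<^sub>R f t)"
    by (rule integral_density) auto
  also have "\<dots> = (LINT t|lborel. (1 / pi) *\<^sub>R (indicator {- pi / 2..pi / 2} t *\<^sub>R f t))"
    by (intro Bochner_Integration.integral_cong) auto
  also have "\<dots> = (1 / pi) *\<^sub>R (LINT t|lborel. indicator {- pi / 2..pi / 2} t *\<^sub>R f t)"
    by (rule integral_scaleR_right)
  finally show ?thesis .
qed

lemma integrable_angle_measure_bounded:
  fixes f :: "real \<Rightarrow> 'b::{banach, second_countable_topology}"
  assumes "f \<in> borel_measurable borel" "\<And>t. norm (f t) \<le> B"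
  shows "integrable angle_measure f"
  using assms by (intro angle.integrable_const_bound[of _ B]) (auto simp: measurable_def)

lemma integrable_cis: "integrable angle_measure (\<lambda>t. cis (t * c))"
  unfolding cis_conv_exp by (rule integrable_angle_measure_bounded[of _ 1]) (auto simp flip: cis_conv_exp)

text \<open>Evenness of b makes the antiderivative agree at both ends of the interval of length pi.
  This is the device that detects balance.\<close>

lemma integral_cis:
  assumes "even b"
  shows "(LINT t|angle_measure. cis (t * real_of_int b)) = (if b = 0 then 1 else 0)"
proof (cases "b = 0")
  case True
  then show ?thesis using angle.prob_space by simp
next
  case False
  from assms obtain c where c: "b = 2 * c" by blast
  define F where "F t = cis (t * real_of_int b) / (\<i> * of_int b)" for t
  have cis_eq: "cis (t * real_of_int b) = exp (\<i> * of_int b * complex_of_real t)" for t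
    by (simp add: cis_conv_exp mult_ac)
  have "((\<lambda>t. cis (t * real_of_int b)) has_vector_derivative
          real_of_int b *\<^sub>R (\<i> * cis (t * real_of_int b))) (at t within X)" for t X
    unfolding cis_eq
    by (rule has_vector_derivative_real_field[where f = "\<lambda>z. exp (\<i> * of_int b * z)"])
       (auto intro!: derivative_eq_intros simp: scaleR_conv_of_real)
  then have "(F has_vector_derivative real_of_int b *\<^sub>R (\<i> * cis (t * real_of_int b)) / (\<i> * of_int b)) (at t within X)" for t X
    unfolding F_def by (rule has_vector_derivative_divide)
  then have d: "(F has_vector_derivative cis (t * real_of_int b)) (at t within X)" for t X
    using False by (simp add: scaleR_conv_of_real)
  have "(LINT t|lborel. indicator {- pi / 2..pi / 2} t *\<^sub>R cis (t * real_of_int b)) = F (pi / 2) - F (- pi / 2)"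
    by (rule integral_FTC_Icc) (auto intro!: d continuous_intros)
  also have "F (pi / 2) = F (- pi / 2)"
  proof -
    have "cis (pi / 2 * real_of_int b) = cis (- pi / 2 * real_of_int b) * cis (2 * pi * real_of_int c)"
      unfolding cis_mult c by (simp add: algebra_simps)
    then show ?thesis by (simp add: F_def cis_multiple_2pi)
  qed
  moreover have "(LINT t|angle_measure. cis (t * real_of_int b))
      = (1 / pi) *\<^sub>R (LINT t|lborel. indicator {- pi / 2..pi / 2} t *\<^sub>R cis (t * real_of_int b))"
    unfolding cis_conv_exp by (rule lebesgue_integral_angle_measure) simp
  ultimately show ?thesis
    using False by simp
qed

text \<open>Binomial expansion of \<open>(cis t + cis (- t)) ^ d / 2 ^ d\<close>; by
  \<open>integral_cis\<close> only the middle frequency survives.\<close>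

lemma integral_cos_power:
  assumes "even d"
  shows "(LINT t|angle_measure. cos t ^ d) = real (d choose (d div 2)) / 2 ^ d"
proof -
  have ex: "of_real (cos t ^ d) = (\<Sum>k\<le>d. of_nat (d choose k) / 2 ^ d * cis (t * real_of_int (2 * int k - int d)))" for t
  proof -
    have "of_real (cos t) = (cis t + cis (- t)) / 2"
      by (simp add: complex_eq_iff)
    then have "of_real (cos t ^ d) = (cis t + cis (- t)) ^ d / 2 ^ d"
      by (simp only: of_real_power power_divide)
    also have "(cis t + cis (- t)) ^ d = (\<Sum>k\<le>d. of_nat (d choose k) * cis t ^ k * cis (- t) ^ (d - k))"
      by (rule binomial_ring)
    also have "\<dots> = (\<Sum>k\<le>d. of_nat (d choose k) * cis (t * real_of_int (2 * int k - int d)))"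
      by (intro sum.cong refl) (simp add: Complex.DeMoivre cis_mult mult.assoc of_nat_diff algebra_simps)
    finally show ?thesis by (simp add: sum_divide_distrib)
  qed
  have "complex_of_real (LINT t|angle_measure. cos t ^ d) = (LINT t|angle_measure. of_real (cos t ^ d))"
    by (rule integral_complex_of_real[symmetric])
  also have "\<dots> = (\<Sum>k\<le>d. of_nat (d choose k) / 2 ^ d * (LINT t|angle_measure. cis (t * real_of_int (2 * int k - int d))))"
    unfolding ex
    by (subst Bochner_Integration.integral_sum)
       (auto intro!: Bochner_Integration.integrable_mult_right integrable_cis simp del: of_int_diff)
  also have "\<dots> = (\<Sum>k\<le>d. if k = d div 2 then of_nat (d choose k) / 2 ^ d else 0)"
    using assms by (intro sum.cong refl) (subst integral_cis, auto)
  also have "\<dots> = of_real (real (d choose (d div 2)) / 2 ^ d)"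
    by simp
  finally show ?thesis
    unfolding of_real_eq_iff .
qed

lemma AE_cos_nonneg: "AE t in angle_measure. 0 \<le> cos t"
  using AE_angle_measure by eventually_elim (auto intro!: cos_ge_zero)

text \<open>For even b the integrand is nonnegative wherever cosine is; for odd b it is an odd
  function and integrates to 0.\<close>

lemma integral_cos_sin_power_nonneg:
  assumes "even (a + b)"
  shows "0 \<le> (LINT t|angle_measure. cos t ^ a * sin t ^ b)"
proof (cases "even b")
  case True
  then show ?thesis
    using AE_cos_nonneg by (intro integral_nonneg_AE) (auto elim!: eventually_mono simp: zero_le_even_power)
next
  case False
  let ?f = "\<lambda>t::real. indicator {- pi / 2..pi / 2} t *\<^sub>R (cos t ^ a * sin t ^ b)"
  have "(LINT t|lborel. ?f t) = (LINT t|lborel. ?f (- t))"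
    using lborel_integral_real_affine[of "-1" ?f 0] by simp
  also have "\<dots> = (LINT t|lborel. - ?f t)"
    using False by (intro Bochner_Integration.integral_cong) (auto split: split_indicator)
  finally have "(LINT t|lborel. ?f t) = 0" by simp
  then show ?thesis
    by (subst lebesgue_integral_angle_measure) auto
qed

section \<open>Edges, degrees and an encoding of orientations\<close>

lemma nsets_2_Min_Max:
  fixes V :: "'a::linorder set"
  assumes "e \<in> nsets V 2"
  shows "e = {Min e, Max e}" "Min e < Max e" "Min e \<in> V" "Max e \<in> V"
proof -
  obtain x y where "e = {x, y}" "x \<in> V" "y \<in> V" "x \<noteq> y"
    using assms by (rule nsets2_E)
  then show "e = {Min e, Max e}" "Min e < Max e" "Min e \<in> V" "Max e \<in> V"
    by (cases "x < y"; auto simp: min_def max_def insert_commute)+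
qed

lemma degree_add_diff:
  assumes "finite E" "F \<subseteq> E"
  shows "degree F v + degree (E - F) v = degree E v"
  unfolding degree_def using assms
  by (subst card_Un_disjoint[symmetric]) (auto intro!: arg_cong[where f = card] intro: finite_subset)

text \<open>Double counting of incidences: the weight of v occurs once for each edge of F at
  v.\<close>

lemma prod_edges_eq_prod_degree:
  fixes c :: "nat \<Rightarrow> 'b::comm_monoid_mult"
  assumes "finite V" "F \<subseteq> nsets V 2"
  shows "(\<Prod>e\<in>F. c (Min e) * c (Max e)) = (\<Prod>v\<in>V. c v ^ degree F v)"
proof -
  have fin: "finite F" using assms finite_imp_finite_nsets finite_subset by blast
  have "(\<Prod>e\<in>F. c (Min e) * c (Max e)) = (\<Prod>e\<in>F. \<Prod>v\<in>{v. v \<in> V \<and> v \<in> e}. c v)"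
  proof (intro prod.cong refl)
    fix e assume "e \<in> F"
    then have e: "e \<in> nsets V 2" using assms by auto
    have "{v. v \<in> V \<and> v \<in> e} = e"
      using e by (auto simp: nsets_def)
    also have "e = {Min e, Max e}" by (rule nsets_2_Min_Max(1)[OF e])
    finally have "{v. v \<in> V \<and> v \<in> e} = {Min e, Max e}" .
    then show "c (Min e) * c (Max e) = (\<Prod>v\<in>{v. v \<in> V \<and> v \<in> e}. c v)"
      using nsets_2_Min_Max(2)[OF e] by simp
  qed
  also have "\<dots> = (\<Prod>v\<in>V. \<Prod>e\<in>{e. e \<in> F \<and> v \<in> e}. c v)"
    by (rule prod.swap_restrict) (use assms fin in auto)
  also have "\<dots> = (\<Prod>v\<in>V. c v ^ degree F v)"
    by (simp add: degree_def)
  finally show ?thesis .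
qed

text \<open>An orientation is encoded by the set \<open>F\<close> of edges directed towards their larger endpoint.\<close>

definition arc :: "nat set set \<Rightarrow> nat set \<Rightarrow> nat \<times> nat" where
  "arc F e = (if e \<in> F then (Min e, Max e) else (Max e, Min e))"

text \<open>The first component of an arc is its tail, so this is out-degree minus in-degree at
  v.\<close>

definition excess :: "nat set set \<Rightarrow> nat set set \<Rightarrow> nat \<Rightarrow> int" where
  "excess E F v = (\<Sum>e\<in>E. of_bool (fst (arc F e) = v) - of_bool (snd (arc F e) = v))"

text \<open>An orientation contains exactly one of the two arcs over each edge, so it is recovered
  from the edges whose increasing arc it contains; this is the inverse map.\<close>

lemma bij_betw_orientations:
  assumes "E \<subseteq> nsets V 2"
  shows "bij_betw (\<lambda>F. arc F ` E) (Pow E) {A. is_orientation E A}"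
proof (rule bij_betwI[where g = "\<lambda>A. {e \<in> E. (Min e, Max e) \<in> A}"])
  let ?u = "\<lambda>(u, v). {u, v :: nat}"
  have u: "?u (arc F e) = e" if "e \<in> E" for F e
    using nsets_2_Min_Max(1)[of e V] that assms by (auto simp: arc_def insert_commute)
  have ne: "Min e \<noteq> Max e" if "e \<in> E" for e
    using nsets_2_Min_Max(2)[of e V] that assms by auto
  show "(\<lambda>F. arc F ` E) \<in> Pow E \<rightarrow> {A. is_orientation E A}"
  proof
    fix F
    have "bij_betw ?u (arc F ` E) E"
    proof -
      have 1: "bij_betw (arc F) E (arc F ` E)"
        by (rule inj_on_imp_bij_betw, rule inj_on_inverseI[of _ ?u], rule u)
      have "bij_betw (?u \<circ> arc F) E E \<longleftrightarrow> bij_betw id E E"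
        by (rule bij_betw_cong) (simp add: u)
      then show ?thesis
        using bij_betw_comp_iff[OF 1, of ?u E] bij_betw_id by blast
    qed
    then show "arc F ` E \<in> {A. is_orientation E A}"
      by (simp add: is_orientation_def)
  qed
  show "(\<lambda>A. {e \<in> E. (Min e, Max e) \<in> A}) \<in> {A. is_orientation E A} \<rightarrow> Pow E"
    by auto
  show "{e \<in> E. (Min e, Max e) \<in> arc F ` E} = F" if "F \<in> Pow E" for F
  proof -
    have "e \<in> F" if e: "e \<in> E" "(Min e, Max e) \<in> arc F ` E" for e
    proof -
      obtain e' where e': "e' \<in> E" "(Min e, Max e) = arc F e'" using e by auto
      have "{Min e, Max e} = e'"
        using u[OF e'(1), of F] unfolding e'(2)[symmetric] by simp
      then have "e' = e" using nsets_2_Min_Max(1)[of e V] e(1) assms by blast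
      then show ?thesis using e' ne[OF e(1)] by (auto simp: arc_def split: if_splits)
    qed
    moreover have "(Min e, Max e) \<in> arc F ` E" if "e \<in> F" for e
      using that \<open>F \<in> Pow E\<close> by (auto simp: arc_def image_iff intro!: bexI[of _ e])
    ultimately show ?thesis using that by auto
  qed
  show "arc {e \<in> E. (Min e, Max e) \<in> A} ` E = A" if "A \<in> {A. is_orientation E A}" for A
  proof -
    have bij: "bij_betw ?u A E" using that by (simp add: is_orientation_def)
    define F where "F = {e \<in> E. (Min e, Max e) \<in> A}"
    have in_A: "arc F e \<in> A" if e: "e \<in> E" for e
    proof (cases "e \<in> F")
      case True
      then show ?thesis by (simp add: F_def arc_def)
    next
      case False
      obtain x y where xy: "(x, y) \<in> A" "{x, y} = e"
        using bij e by (auto simp: bij_betw_def image_iff)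
      have "{Min e, Max e} = e" using nsets_2_Min_Max(1)[of e V] e assms by auto
      then have "(x, y) = (Min e, Max e) \<or> (x, y) = (Max e, Min e)"
        using xy by (metis doubleton_eq_iff)
      then show ?thesis using False xy e by (auto simp: F_def arc_def)
    qed
    have "a \<in> arc F ` E" if a: "a \<in> A" for a
    proof -
      have "?u a \<in> E" using bij a by (auto simp: bij_betw_def)
      moreover have "a = arc F (?u a)"
        using bij in_A[OF calculation] u[OF calculation, of F] a
        unfolding bij_betw_def by (metis inj_onD)
      ultimately show ?thesis by blast
    qed
    then show ?thesis using in_A unfolding F_def by auto
  qed
qed

text \<open>An arc determines its edge, so \<open>arc F\<close> is injective on E and the arcs into
  or out of v may be counted by edges.\<close>

lemma balanced_iff_excess_eq_0:
  assumes "finite E" "E \<subseteq> nsets V 2"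
  shows "card {u. (u, v) \<in> arc F ` E} = card {w. (v, w) \<in> arc F ` E} \<longleftrightarrow> excess E F v = 0"
proof -
  have u: "(\<lambda>(u, v). {u, v}) (arc F e) = e" if "e \<in> E" for e
    using nsets_2_Min_Max(1)[of e V] that assms by (auto simp: arc_def insert_commute)
  have inj: "inj_on (arc F) E"
    by (rule inj_on_inverseI[of _ "\<lambda>(u, v). {u, v}"]) (rule u)
  have 1: "card {u. (u, v) \<in> arc F ` E} = card {e\<in>E. snd (arc F e) = v}"
  proof -
    have *: "{u. (u, v) \<in> X} = fst ` {a \<in> X. snd a = v}" for X :: "(nat \<times> nat) set"
      by force
    have "{u. (u, v) \<in> arc F ` E} = fst ` {a \<in> arc F ` E. snd a = v}"
      by (rule *)
    also have "{a \<in> arc F ` E. snd a = v} = arc F ` {e\<in>E. snd (arc F e) = v}"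
      by auto
    finally have "{u. (u, v) \<in> arc F ` E} = (\<lambda>e. fst (arc F e)) ` {e\<in>E. snd (arc F e) = v}"
      by (simp add: image_image)
    moreover have "inj_on (\<lambda>e. fst (arc F e)) {e\<in>E. snd (arc F e) = v}"
      using inj by (auto simp: inj_on_def prod_eq_iff)
    ultimately show ?thesis by (simp add: card_image)
  qed
  have 2: "card {w. (v, w) \<in> arc F ` E} = card {e\<in>E. fst (arc F e) = v}"
  proof -
    have *: "{w. (v, w) \<in> X} = snd ` {a \<in> X. fst a = v}" for X :: "(nat \<times> nat) set"
      by force
    have "{w. (v, w) \<in> arc F ` E} = snd ` {a \<in> arc F ` E. fst a = v}"
      by (rule *)
    also have "{a \<in> arc F ` E. fst a = v} = arc F ` {e\<in>E. fst (arc F e) = v}"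
      by auto
    finally have "{w. (v, w) \<in> arc F ` E} = (\<lambda>e. snd (arc F e)) ` {e\<in>E. fst (arc F e) = v}"
      by (simp add: image_image)
    moreover have "inj_on (\<lambda>e. snd (arc F e)) {e\<in>E. fst (arc F e) = v}"
      using inj by (auto simp: inj_on_def prod_eq_iff)
    ultimately show ?thesis by (simp add: card_image)
  qed
  have "excess E F v = int (card {e\<in>E. fst (arc F e) = v}) - int (card {e\<in>E. snd (arc F e) = v})"
  proof -
    have "{e\<in>E. P e} = E \<inter> {e. P e}" for P by auto
    then show ?thesis
      unfolding excess_def sum_subtractf using assms(1) by (simp add: sum_of_bool_eq)
  qed
  then show ?thesis unfolding 1 2 by auto
qed

lemma EO_eq_card:
  assumes "E \<subseteq> nsets {1..n} 2"
  shows "EO n E = card {F \<in> Pow E. \<forall>v\<in>{1..n}. excess E F v = 0}"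
proof -
  have fin: "finite E" using assms finite_imp_finite_nsets finite_subset finite_atLeastAtMost by blast
  have "bij_betw (\<lambda>F. arc F ` E) {F \<in> Pow E. \<forall>v\<in>{1..n}. excess E F v = 0}
      {A \<in> {A. is_orientation E A}. \<forall>v\<in>{1..n}. card {u. (u, v) \<in> A} = card {w. (v, w) \<in> A}}"
    by (rule bij_betw_Collect[OF bij_betw_orientations[OF assms]])
       (simp only: balanced_iff_excess_eq_0[OF fin assms])
  then have "bij_betw (\<lambda>F. arc F ` E) {F \<in> Pow E. \<forall>v\<in>{1..n}. excess E F v = 0} (eulerian_orientations n E)"
    by (simp add: eulerian_orientations_def)
  then show ?thesis
    unfolding EO_def by (rule bij_betw_same_card[symmetric])
qed

section \<open>The integral formula and the lower bound\<close>

text \<open>With angle 0 the vertices outside U contribute nothing to the phase, which amounts to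
  imposing no balance condition there.\<close>

definition extend :: "nat set \<Rightarrow> (nat \<Rightarrow> real) \<Rightarrow> nat \<Rightarrow> real" where
  "extend U x v = (if v \<in> U then x v else 0)"

lemma measurable_extend [measurable]:
  "(\<lambda>x. extend U x v) \<in> borel_measurable (Pi\<^sub>M U (\<lambda>_. angle_measure))"
  by (cases "v \<in> U") (simp_all add: extend_def)

lemma prod_cis: "(\<Prod>i\<in>A. cis (f i)) = cis (\<Sum>i\<in>A. f i)"
  by (induction A rule: infinite_finite_induct) (auto simp: cis_mult)

text \<open>Each edge at v contributes 1 or -1, so the excess has the parity of the degree. This
  makes \<open>integral_cis\<close> applicable.\<close>

lemma even_excess:
  assumes "finite E" "E \<subseteq> nsets V 2" "even (degree E v)"
  shows "even (excess E F v)"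
proof -
  have "excess E F v = (\<Sum>e\<in>E. of_bool (v \<in> e) - 2 * of_bool (snd (arc F e) = v))"
    unfolding excess_def
  proof (intro sum.cong refl)
    fix e assume "e \<in> E"
    then have e: "e \<in> nsets V 2" using assms by auto
    have "v \<in> e \<longleftrightarrow> v = Min e \<or> v = Max e"
      by (subst nsets_2_Min_Max(1)[OF e]) simp
    then show "(of_bool (fst (arc F e) = v) - of_bool (snd (arc F e) = v) :: int)
        = of_bool (v \<in> e) - 2 * of_bool (snd (arc F e) = v)"
      using nsets_2_Min_Max(2)[OF e] by (auto simp: arc_def)
  qed
  also have "\<dots> = int (degree E v) - 2 * (\<Sum>e\<in>E. of_bool (snd (arc F e) = v))"
  proof -
    have "{e\<in>E. v \<in> e} = E \<inter> {e. v \<in> e}" by auto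
    then show ?thesis
      using assms(1) by (simp add: sum_subtractf sum_distrib_left degree_def sum_of_bool_eq)
  qed
  finally show ?thesis using assms(3) by simp
qed

lemma sum_excess:
  assumes "finite E" "finite U"
  shows "(\<Sum>v\<in>U. x v * real_of_int (excess E F v))
           = (\<Sum>e\<in>E. extend U x (fst (arc F e)) - extend U x (snd (arc F e)))"
proof -
  have "(\<Sum>v\<in>U. x v * real_of_int (excess E F v))
      = (\<Sum>e\<in>E. \<Sum>v\<in>U. x v * of_bool (fst (arc F e) = v) - x v * of_bool (snd (arc F e) = v))"
    unfolding excess_def by (subst sum.swap) (simp add: sum_distrib_left algebra_simps)
  also have "(\<Sum>v\<in>U. x v * of_bool (w = v)) = extend U x w" for w
    using assms(2) by (simp add: extend_def of_bool_def if_distrib cong: if_cong)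
  then have "(\<Sum>e\<in>E. \<Sum>v\<in>U. x v * of_bool (fst (arc F e) = v) - x v * of_bool (snd (arc F e) = v))
      = (\<Sum>e\<in>E. extend U x (fst (arc F e)) - extend U x (snd (arc F e)))"
    by (simp add: sum_subtractf)
  finally show ?thesis .
qed

text \<open>Each edge independently contributes \<open>cis\<close> of plus or minus its angle
  difference, so the sum over orientations factors into edge sums, each twice a cosine.\<close>

lemma sum_orientations_cis:
  assumes "finite E"
  shows "(\<Sum>F\<in>Pow E. \<Prod>e\<in>E. cis (y (fst (arc F e)) - y (snd (arc F e))))
           = of_real (2 ^ card E * (\<Prod>e\<in>E. cos (y (Min e) - y (Max e))))"
proof -
  define \<phi> where "\<phi> e = y (Min e) - y (Max e)" for e
  have "(\<Prod>e\<in>E. cis (y (fst (arc F e)) - y (snd (arc F e)))) = (\<Prod>e\<in>F. cis (\<phi> e)) * (\<Prod>e\<in>E - F. cis (- \<phi> e))"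
    if "F \<in> Pow E" for F
  proof -
    have "(\<Prod>e\<in>E. cis (y (fst (arc F e)) - y (snd (arc F e))))
        = (\<Prod>e\<in>E - F. cis (y (fst (arc F e)) - y (snd (arc F e)))) * (\<Prod>e\<in>F. cis (y (fst (arc F e)) - y (snd (arc F e))))"
      using that assms by (intro prod.subset_diff) auto
    also have "(\<Prod>e\<in>E - F. cis (y (fst (arc F e)) - y (snd (arc F e)))) = (\<Prod>e\<in>E - F. cis (- \<phi> e))"
      by (intro prod.cong refl) (simp add: arc_def \<phi>_def)
    also have "(\<Prod>e\<in>F. cis (y (fst (arc F e)) - y (snd (arc F e)))) = (\<Prod>e\<in>F. cis (\<phi> e))"
      by (intro prod.cong refl) (simp add: arc_def \<phi>_def)
    finally show ?thesis
      by (simp add: mult.commute)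
  qed
  then have "(\<Sum>F\<in>Pow E. \<Prod>e\<in>E. cis (y (fst (arc F e)) - y (snd (arc F e))))
      = (\<Prod>e\<in>E. cis (\<phi> e) + cis (- \<phi> e))"
    using assms by (subst prod_add) (auto intro: sum.cong)
  also have "\<dots> = (\<Prod>e\<in>E. of_real (2 * cos (\<phi> e)))"
    by (intro prod.cong refl) (simp add: complex_eq_iff)
  also have "\<dots> = of_real (2 ^ card E * (\<Prod>e\<in>E. cos (\<phi> e)))"
    by (simp only: of_real_prod[symmetric] prod.distrib prod_constant)
  finally show ?thesis unfolding \<phi>_def .
qed

text \<open>By \<open>integral_cis\<close> the indicator of balance at v is the mean of
  \<open>cis (t * real_of_int (excess E F v))\<close>. Multiplying over U and summing over
  orientations under the integral sign leaves a product of cosines.\<close>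

lemma card_balanced_eq_integral:
  assumes "finite V" "E \<subseteq> nsets V 2" "U \<subseteq> V" "\<And>v. v \<in> U \<Longrightarrow> even (degree E v)"
  shows "real (card {F \<in> Pow E. \<forall>v\<in>U. excess E F v = 0})
           = 2 ^ card E * (LINT x|(Pi\<^sub>M U (\<lambda>_. angle_measure)).
               (\<Prod>e\<in>E. cos (extend U x (Min e) - extend U x (Max e))))"
proof -
  let ?M = "Pi\<^sub>M U (\<lambda>_. angle_measure)"
  have finE: "finite E" using assms finite_imp_finite_nsets finite_subset by blast
  have finU: "finite U" using assms finite_subset by blast
  have "complex_of_real (real (card {F \<in> Pow E. \<forall>v\<in>U. excess E F v = 0}))
      = (\<Sum>F\<in>Pow E. of_bool (\<forall>v\<in>U. excess E F v = 0))"
  proof -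
    have "{F \<in> Pow E. \<forall>v\<in>U. excess E F v = 0} = Pow E \<inter> {F. \<forall>v\<in>U. excess E F v = 0}"
      by auto
    then show ?thesis using finE by (simp add: sum_of_bool_eq)
  qed
  also have "\<dots> = (\<Sum>F\<in>Pow E. \<Prod>v\<in>U. (LINT t|angle_measure. cis (t * real_of_int (excess E F v))))"
  proof (intro sum.cong refl)
    fix F
    have "(LINT t|angle_measure. cis (t * real_of_int (excess E F v))) = of_bool (excess E F v = 0)" if "v \<in> U" for v
      using integral_cis[OF even_excess[OF finE assms(2) assms(4)[OF that]], of F] by simp
    then show "of_bool (\<forall>v\<in>U. excess E F v = 0)
        = (\<Prod>v\<in>U. (LINT t|angle_measure. cis (t * real_of_int (excess E F v))))"
      using finU by (auto simp: prod_zero_iff)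
  qed
  also have "\<dots> = (\<Sum>F\<in>Pow E. (LINT x|?M. (\<Prod>v\<in>U. cis (x v * real_of_int (excess E F v)))))"
    by (intro sum.cong refl angles.product_integral_prod[symmetric] finU integrable_cis)
  also have "\<dots> = (LINT x|?M. (\<Sum>F\<in>Pow E. \<Prod>v\<in>U. cis (x v * real_of_int (excess E F v))))"
    by (intro Bochner_Integration.integral_sum[symmetric] angles.product_integrable_prod finU integrable_cis)
  also have "\<dots> = (LINT x|?M. of_real (2 ^ card E * (\<Prod>e\<in>E. cos (extend U x (Min e) - extend U x (Max e)))))"
    \<comment> \<open>The product over vertices is merged into one phase, regrouped by edges and
      split again.\<close>
    unfolding prod_cis sum_excess[OF finE finU] unfolding prod_cis[symmetric]
    by (simp only: sum_orientations_cis[OF finE])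
  also have "\<dots> = of_real (LINT x|?M. 2 ^ card E * (\<Prod>e\<in>E. cos (extend U x (Min e) - extend U x (Max e))))"
    by (rule integral_complex_of_real)
  finally show ?thesis
    unfolding of_real_eq_iff by simp
qed

text \<open>The factor 2 of each edge is shared equally by its two ends.\<close>

lemma two_power_card_edges:
  assumes "finite V" "E \<subseteq> nsets V 2"
  shows "2 ^ card E = (\<Prod>v\<in>V. sqrt 2 ^ degree E v)"
proof -
  have "(\<Prod>e\<in>E. sqrt 2 * sqrt 2) = (\<Prod>v\<in>V. sqrt 2 ^ degree E v)"
    using prod_edges_eq_prod_degree[OF assms, of "\<lambda>_. sqrt 2"] .
  then show ?thesis by simp
qed

text \<open>Expanding \<open>cos (a - b) = cos a * cos b + sin a * sin b\<close> over all edges, every term has a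
  nonnegative integral, and the term without sines is the product on the right.\<close>

lemma card_balanced_ge:
  assumes "finite V" "E \<subseteq> nsets V 2" "\<And>v. v \<in> V \<Longrightarrow> even (degree E v)"
  shows "2 ^ card E * (\<Prod>v\<in>V. real (degree E v choose (degree E v div 2)) / 2 ^ degree E v)
           \<le> real (card {F \<in> Pow E. \<forall>v\<in>V. excess E F v = 0})"
proof -
  let ?M = "Pi\<^sub>M V (\<lambda>_. angle_measure)"
  have finE: "finite E" using assms finite_imp_finite_nsets finite_subset by blast
  have int: "integrable angle_measure (\<lambda>t. cos t ^ a * sin t ^ b)" for a b
    by (rule integrable_angle_measure_bounded[of _ 1])
       (auto simp: abs_mult power_abs intro!: mult_le_one power_le_one)
  define g where "g F v t = cos t ^ degree F v * sin t ^ degree (E - F) v" for F v and t :: real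
  have "(LINT x|?M. (\<Prod>e\<in>E. cos (extend V x (Min e) - extend V x (Max e))))
      = (LINT x|?M. (\<Sum>F\<in>Pow E. \<Prod>v\<in>V. g F v (x v)))"
  proof (intro Bochner_Integration.integral_cong refl)
    fix x
    have "(\<Prod>e\<in>E. cos (extend V x (Min e) - extend V x (Max e)))
        = (\<Prod>e\<in>E. cos (x (Min e)) * cos (x (Max e)) + sin (x (Min e)) * sin (x (Max e)))"
    proof (intro prod.cong refl)
      fix e assume "e \<in> E"
      then have e: "e \<in> nsets V 2" using assms by auto
      show "cos (extend V x (Min e) - extend V x (Max e))
          = cos (x (Min e)) * cos (x (Max e)) + sin (x (Min e)) * sin (x (Max e))"
        using nsets_2_Min_Max[OF e] by (simp add: extend_def cos_diff)
    qed
    also have "\<dots> = (\<Sum>F\<in>Pow E. (\<Prod>e\<in>F. cos (x (Min e)) * cos (x (Max e))) * (\<Prod>e\<in>E - F. sin (x (Min e)) * sin (x (Max e))))"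
      by (rule prod_add[OF finE])
    also have "\<dots> = (\<Sum>F\<in>Pow E. \<Prod>v\<in>V. g F v (x v))"
    proof (intro sum.cong refl)
      fix F assume "F \<in> Pow E"
      then have "F \<subseteq> nsets V 2" "E - F \<subseteq> nsets V 2" using assms by auto
      then show "(\<Prod>e\<in>F. cos (x (Min e)) * cos (x (Max e))) * (\<Prod>e\<in>E - F. sin (x (Min e)) * sin (x (Max e)))
          = (\<Prod>v\<in>V. g F v (x v))"
        using prod_edges_eq_prod_degree[OF assms(1), of F "\<lambda>v. cos (x v)"]
          prod_edges_eq_prod_degree[OF assms(1), of "E - F" "\<lambda>v. sin (x v)"]
        by (simp add: g_def prod.distrib)
    qed
    finally show "(\<Prod>e\<in>E. cos (extend V x (Min e) - extend V x (Max e))) = (\<Sum>F\<in>Pow E. \<Prod>v\<in>V. g F v (x v))" .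
  qed
  also have "\<dots> = (\<Sum>F\<in>Pow E. (LINT x|?M. (\<Prod>v\<in>V. g F v (x v))))"
    by (intro Bochner_Integration.integral_sum angles.product_integrable_prod assms(1)) (simp add: g_def int)
  also have "\<dots> = (\<Sum>F\<in>Pow E. \<Prod>v\<in>V. (LINT t|angle_measure. g F v t))"
    by (intro sum.cong refl angles.product_integral_prod assms(1)) (simp add: g_def int)
  \<comment> \<open>Only the term \<open>F = E\<close>, with a cosine at both ends of every edge, is
    kept.\<close>
  also have "\<dots> \<ge> (\<Sum>F\<in>{E}. \<Prod>v\<in>V. (LINT t|angle_measure. g F v t))"
  proof (intro sum_mono2 prod_nonneg ballI)
    fix F v assume "F \<in> Pow E - {E}" "v \<in> V"
    then have "even (degree F v + degree (E - F) v)"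
      using degree_add_diff[OF finE, of F v] assms(3) by auto
    then show "0 \<le> (LINT t|angle_measure. g F v t)"
      unfolding g_def by (rule integral_cos_sin_power_nonneg)
  qed (use finE in auto)
  also have "(\<Sum>F\<in>{E}. \<Prod>v\<in>V. (LINT t|angle_measure. g F v t))
      = (\<Prod>v\<in>V. real (degree E v choose (degree E v div 2)) / 2 ^ degree E v)"
    using assms(3) by (simp add: g_def integral_cos_power degree_def)
  finally show ?thesis
    by (subst card_balanced_eq_integral[OF assms(1,2) subset_refl assms(3)]) (auto intro: mult_left_mono)
qed

section \<open>Graphs with a pinned set of vertices\<close>

definition nbrs :: "nat set set \<Rightarrow> nat \<Rightarrow> nat set" where
  "nbrs E v = {u. {v, u} \<in> E}"

lemma in_nbrs_commute: "u \<in> nbrs E v \<longleftrightarrow> v \<in> nbrs E u"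
  by (simp add: nbrs_def insert_commute)

lemma nbrs_subset:
  assumes "E \<subseteq> nsets V 2"
  shows "nbrs E v \<subseteq> V - {v}"
proof
  fix u assume "u \<in> nbrs E v"
  then have "{v, u} \<in> nsets V 2" using assms unfolding nbrs_def by blast
  then show "u \<in> V - {v}" unfolding doubleton_in_nsets_2 by auto
qed

lemma degree_eq_card_nbrs:
  assumes "E \<subseteq> nsets V 2"
  shows "degree E v = card (nbrs E v)"
proof -
  have "{e \<in> E. v \<in> e} = (\<lambda>u. {v, u}) ` nbrs E v"
  proof (intro set_eqI iffI)
    fix e assume e: "e \<in> {e \<in> E. v \<in> e}"
    then have "e \<in> nsets V 2" using assms by auto
    then obtain a b where "e = {a, b}" by (rule nsets2_E)
    then show "e \<in> (\<lambda>u. {v, u}) ` nbrs E v"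
      using e by (auto simp: nbrs_def insert_commute)
  qed (auto simp: nbrs_def)
  moreover have "inj_on (\<lambda>u. {v, u}) (nbrs E v)"
    by (auto simp: inj_on_def doubleton_eq_iff)
  ultimately show ?thesis by (simp add: degree_def card_image)
qed

text \<open>The energy of e as a unit resistor under the potential y; \<open>Min\<close> and
  \<open>Max\<close> order the two ends, and the square forgets this order.\<close>

definition sqdiff :: "(nat \<Rightarrow> real) \<Rightarrow> nat set \<Rightarrow> real" where
  "sqdiff y e = (y (Min e) - y (Max e))\<^sup>2"

lemma sqdiff_doubleton: "sqdiff y {a, b} = (y a - y b)\<^sup>2"
  by (cases a b rule: linorder_cases) (auto simp: sqdiff_def min_def max_def power2_commute)

lemma sqdiff_nonneg [simp]: "0 \<le> sqdiff y e"
  by (simp add: sqdiff_def)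

text \<open>Conductances \<open>1\<close> and \<open>p\<close> in series.\<close>

lemma series_conductance_le:
  fixes p t :: real
  assumes "p \<ge> 0"
  shows "1 - 1 / (1 + p) \<le> (1 - t)\<^sup>2 + p * t\<^sup>2"
proof -
  have "(1 + p) * ((1 - t)\<^sup>2 + p * t\<^sup>2) - p = ((1 + p) * t - 1)\<^sup>2"
    by (simp add: power2_eq_square algebra_simps)
  then have "p \<le> (1 + p) * ((1 - t)\<^sup>2 + p * t\<^sup>2)"
    by (smt (verit) zero_le_power2)
  then have "p / (1 + p) \<le> (1 - t)\<^sup>2 + p * t\<^sup>2"
    using assms by (simp add: pos_divide_le_eq mult.commute)
  also have "p / (1 + p) = 1 - 1 / (1 + p)"
    using assms by (simp add: field_simps)
  finally show ?thesis .
qed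

text \<open>By \<open>k3\<close> the series losses at a vertex total at most a quarter of its
  degree. By \<open>k_large\<close> the factor 2^(-k/2) earned by an outlier beats its loss in the
  exponent, \<open>(1 + 4 / \<gamma>) * ln D + 1 / \<gamma>\<close>, with one \<open>ln D\<close> to
  spare.\<close>

locale pinned_graph =
  fixes V :: "nat set" and E :: "nat set set" and S :: "nat set" and D \<gamma> k :: real
  assumes finV: "finite V" and E: "E \<subseteq> nsets V 2" and S: "S \<subseteq> V"
    and D: "2 \<le> D" and \<gamma>: "0 < \<gamma>" and k3: "3 \<le> k"
    and deg_le: "\<And>v. v \<in> V \<Longrightarrow> real (degree E v) \<le> D"
    and deg_ge: "\<And>v. v \<in> V \<Longrightarrow> \<gamma> * D \<le> real (degree E v)"
    and pinned: "\<And>v. v \<in> V - S \<Longrightarrow> k \<le> real (card (nbrs E v \<inter> S))"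
    and k_large: "(2 + 4 / \<gamma>) * ln D + 1 / \<gamma> \<le> k * (ln 2 / 2)"
begin

lemma finE: "finite E"
  using finV E finite_imp_finite_nsets finite_subset by blast

lemma finS: "finite S" using finV S finite_subset by blast

lemma fin_nbrs: "finite (nbrs E v)"
  using nbrs_subset[OF E] finV finite_subset by blast

lemma deg_pos: "v \<in> V \<Longrightarrow> 0 < real (degree E v)"
  using deg_ge[of v] D \<gamma> mult_pos_pos[of \<gamma> D] by linarith

text \<open>\<open>X\<close> is the set of vertices whose angles exceed \<open>\<pi>/4\<close>; the variables in \<open>good X\<close> are integrated
  out in increasing order, and \<open>pins X u v\<close> are the neighbours of \<open>u\<close> still fixed after \<open>v\<close>.\<close>

definition good :: "nat set \<Rightarrow> nat set" where
  "good X = {v \<in> V - S - X. 4 * card (nbrs E v \<inter> X) \<le> degree E v}"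

definition pins :: "nat set \<Rightarrow> nat \<Rightarrow> nat \<Rightarrow> nat set" where
  "pins X u v = {w \<in> nbrs E u - X. \<not> (w \<in> good X \<and> w \<le> v)}"

text \<open>An edge to an already integrated neighbour with p pins conducts
  \<open>1 - 1 / (1 + p)\<close> instead of 1; these are the shortfalls.\<close>

definition loss :: "nat set \<Rightarrow> nat \<Rightarrow> real" where
  "loss X v = (\<Sum>u | u \<in> good X \<and> u \<in> nbrs E v \<and> u < v. 1 / (1 + real (card (pins X u v))))"

text \<open>Only a lower bound for the Gaussian pivot: edges to X are lost, and every other
  neighbour is charged separately.\<close>

definition pivot :: "nat set \<Rightarrow> nat \<Rightarrow> real" where
  "pivot X v = real (degree E v) - real (card (nbrs E v \<inter> X)) - loss X v"

lemma fin_good: "finite (good X)"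
  using finV by (simp add: good_def)

lemma good_subset: "good X \<subseteq> V - S"
  by (auto simp: good_def)

lemma fin_pins: "finite (pins X u v)"
  using fin_nbrs by (simp add: pins_def)

lemma k_le_card_pins:
  assumes "X \<subseteq> V - S" "u \<in> V - S"
  shows "k \<le> real (card (pins X u v))"
proof -
  have "nbrs E u \<inter> S \<subseteq> pins X u v"
    using assms by (auto simp: pins_def good_def)
  then have "card (nbrs E u \<inter> S) \<le> card (pins X u v)"
    using fin_pins by (rule card_mono[rotated])
  then show ?thesis using pinned[OF assms(2)] by linarith
qed

text \<open>Each neighbour u of v outside X gets its own set of edges: the edge to v, together with
  the star from u to its pins if u was integrated before v. The sets are disjoint, so their energies
  add up, and the series law bounds each from below.\<close>

lemma pivot_le:
  assumes X: "X \<subseteq> V - S" and v: "v \<in> good X" and yv: "y v = 1"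
    and y0: "\<And>w. w \<in> V \<Longrightarrow> \<not> (w \<in> good X \<and> w \<le> v) \<Longrightarrow> y w = 0"
  shows "pivot X v \<le> (\<Sum>e | e \<in> E \<and> e \<inter> X = {}. sqdiff y e)"
proof -
  define N where "N = nbrs E v - X"
  define free where "free = {u \<in> N. u \<in> good X \<and> u < v}"
  define P where "P u = (if u \<in> free then insert {v, u} ((\<lambda>w. {u, w}) ` pins X u v) else {{v, u}})" for u
  have vX: "v \<notin> X" "v \<in> V" using v by (auto simp: good_def)
  have N: "u \<noteq> v" "u \<in> V" "{v, u} \<in> E" "u \<notin> X" if "u \<in> N" for u
    using that nbrs_subset[OF E, of v] by (auto simp: N_def nbrs_def)
  have finN: "finite N" using fin_nbrs by (simp add: N_def)
  have pin: "w \<noteq> v" "w \<noteq> u" "w \<in> V" "w \<notin> X" "{u, w} \<in> E" "\<not> (w \<in> good X \<and> w \<le> v)" "y w = 0"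
    if "w \<in> pins X u v" for u w
    using that nbrs_subset[OF E, of u] v y0[of w] by (auto simp: pins_def nbrs_def)
  have finP: "finite (P u)" for u
    using fin_pins by (simp add: P_def)
  \<comment> \<open>Edges of a star avoid v, and their far ends are pins, hence not centres of other
    stars.\<close>
  have disj: "P u \<inter> P u' = {}" if "u \<in> N" "u' \<in> N" "u \<noteq> u'" for u u'
  proof -
    have "{v, a} \<noteq> {b, w}" if "a \<in> N" "b \<in> N" "w \<in> pins X b v" for a b w
      using that pin[of w b] N by (auto simp: doubleton_eq_iff)
    moreover have "{a, w} \<noteq> {b, w'}" if "a \<in> free" "b \<in> free" "a \<noteq> b" "w \<in> pins X a v" "w' \<in> pins X b v" for a b w w'
      using that pin[of w a] pin[of w' b] by (auto simp: doubleton_eq_iff free_def)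
    moreover have "{v, u} \<noteq> {v, u'}" using that by (auto simp: doubleton_eq_iff)
    ultimately show ?thesis
      using that unfolding P_def by (auto 0 3 simp: eq_commute)
  qed
  have contrib: "1 - (if u \<in> free then 1 / (1 + real (card (pins X u v))) else 0) \<le> (\<Sum>e\<in>P u. sqdiff y e)"
    if "u \<in> N" for u
  proof (cases "u \<in> free")
    case True
    have inj: "inj_on (\<lambda>w. {u, w}) (pins X u v)"
      by (auto simp: inj_on_def doubleton_eq_iff)
    have "{v, u} \<notin> (\<lambda>w. {u, w}) ` pins X u v"
      using pin(1)[of v u] N[OF that] by (auto simp: doubleton_eq_iff)
    then have "(\<Sum>e\<in>P u. sqdiff y e) = (y v - y u)\<^sup>2 + (\<Sum>w\<in>pins X u v. (y u - y w)\<^sup>2)"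
      using True fin_pins by (simp add: P_def sum.reindex[OF inj] sqdiff_doubleton)
    also have "(\<Sum>w\<in>pins X u v. (y u - y w)\<^sup>2) = real (card (pins X u v)) * (y u)\<^sup>2"
      using pin by simp
    finally show ?thesis
      using True yv series_conductance_le[of "real (card (pins X u v))" "y u"] by simp
  next
    case False
    then have "y u = 0"
      using that N[OF that] by (intro y0) (auto simp: free_def)
    then show ?thesis using False yv by (simp add: P_def sqdiff_doubleton)
  qed
  have "pivot X v = (\<Sum>u\<in>N. 1 - (if u \<in> free then 1 / (1 + real (card (pins X u v))) else 0))"
  proof -
    have "real (card (nbrs E v)) = real (card N) + real (card (nbrs E v \<inter> X))"
      unfolding N_def using fin_nbrs[of v] by (metis card_Int_Diff add.commute of_nat_add)
    moreover have "{u. u \<in> good X \<and> u \<in> nbrs E v \<and> u < v} = free"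
      by (auto simp: free_def N_def good_def)
    moreover have "(\<Sum>u\<in>N. if u \<in> free then 1 / (1 + real (card (pins X u v))) else 0)
        = (\<Sum>u\<in>free. 1 / (1 + real (card (pins X u v))))"
      using finN by (subst sum.inter_restrict[symmetric]) (auto simp: free_def intro: sum.cong)
    ultimately show ?thesis
      by (simp add: pivot_def loss_def degree_eq_card_nbrs[OF E] sum_subtractf)
  qed
  also have "\<dots> \<le> (\<Sum>u\<in>N. \<Sum>e\<in>P u. sqdiff y e)"
    by (intro sum_mono contrib)
  also have "\<dots> = (\<Sum>e\<in>(\<Union>u\<in>N. P u). sqdiff y e)"
    by (rule sum.UNION_disjoint[symmetric]) (use finN finP disj in auto)
  also have "\<dots> \<le> (\<Sum>e | e \<in> E \<and> e \<inter> X = {}. sqdiff y e)"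
  proof (rule sum_mono2)
    have "P u \<subseteq> {e. e \<in> E \<and> e \<inter> X = {}}" if "u \<in> N" for u
      using N[OF that] vX pin[of _ u] by (auto simp: P_def)
    then show "(\<Union>u\<in>N. P u) \<subseteq> {e. e \<in> E \<and> e \<inter> X = {}}" by blast
  qed (use finE in auto)
  finally show ?thesis .
qed

text \<open>Every earlier good neighbour keeps its pins in S, at least three of them, so each
  summand is at most 1/4.\<close>

lemma loss_le:
  assumes "X \<subseteq> V - S"
  shows "loss X v \<le> real (degree E v) / 4"
proof -
  let ?A = "{u. u \<in> good X \<and> u \<in> nbrs E v \<and> u < v}"
  have "loss X v \<le> (\<Sum>u\<in>?A. 1 / 4)"
    unfolding loss_def
  proof (rule sum_mono)
    fix u assume "u \<in> ?A"
    then have "k \<le> real (card (pins X u v))"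
      using good_subset by (intro k_le_card_pins assms) auto
    then show "1 / (1 + real (card (pins X u v))) \<le> 1 / 4"
      using k3 by (intro divide_left_mono) auto
  qed
  also have "\<dots> \<le> real (card (nbrs E v)) / 4"
    using fin_nbrs[of v] by (auto intro!: card_mono)
  finally show ?thesis by (simp add: degree_eq_card_nbrs[OF E])
qed

lemma loss_nonneg: "0 \<le> loss X v"
  by (auto simp: loss_def intro!: sum_nonneg)

text \<open>The sum is regrouped by u. The good neighbours of u that come after v are still pins of
  u when v is integrated, so the terms for u are dominated by 1, 1/2, 1/3, ..., whatever the order
  of the vertices.\<close>

lemma sum_loss_le: "(\<Sum>v\<in>good X. loss X v) \<le> real (card V) * (1 + ln D)"
proof -
  define f where "f u v = 1 / (1 + real (card (pins X u v)))" for u v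
  have "(\<Sum>v\<in>good X. loss X v) = (\<Sum>v\<in>good X. \<Sum>u\<in>{u. u \<in> good X \<and> (u \<in> nbrs E v \<and> u < v)}. f u v)"
    by (simp add: loss_def f_def)
  also have "\<dots> = (\<Sum>u\<in>good X. \<Sum>v\<in>{v. v \<in> good X \<and> (u \<in> nbrs E v \<and> u < v)}. f u v)"
    by (rule sum.swap_restrict[OF fin_good fin_good])
  also have "\<dots> \<le> (\<Sum>u\<in>good X. 1 + ln D)"
  proof (rule sum_mono)
    fix u assume u: "u \<in> good X"
    define J where "J = {v. v \<in> good X \<and> (u \<in> nbrs E v \<and> u < v)}"
    have J: "J \<subseteq> nbrs E u" by (auto simp: J_def in_nbrs_commute)
    have finJ: "finite J" using J fin_nbrs finite_subset by blast
    have "(\<Sum>v\<in>J. f u v) \<le> (\<Sum>v\<in>J. 1 / (1 + real (card {i\<in>J. v < i})))"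
    proof (rule sum_mono)
      fix v assume "v \<in> J"
      have "{i\<in>J. v < i} \<subseteq> pins X u v"
        using J by (auto simp: pins_def J_def good_def)
      then have "card {i\<in>J. v < i} \<le> card (pins X u v)"
        by (rule card_mono[OF fin_pins])
      then show "f u v \<le> 1 / (1 + real (card {i\<in>J. v < i}))"
        unfolding f_def by (intro divide_left_mono) auto
    qed
    also have "\<dots> \<le> harm (card J)"
      by (rule sum_inverse_rank_le_harm[OF finJ])
    also have "\<dots> \<le> 1 + ln D"
    proof (cases "card J = 0")
      case True
      then show ?thesis using D by (simp add: harm_def)
    next
      case False
      have "card J \<le> card (nbrs E u)" using J fin_nbrs by (intro card_mono)
      moreover have "real (card (nbrs E u)) \<le> D"
        using deg_le[of u] u by (auto simp: degree_eq_card_nbrs[OF E] good_def)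
      ultimately have "real (card J) \<le> D" by linarith
      then show ?thesis
        using False harm_le_one_plus_ln[of "card J"] by (smt (verit) ln_mono of_nat_0_less_iff neq0_conv)
    qed
    finally show "(\<Sum>v\<in>{v. v \<in> good X \<and> (u \<in> nbrs E v \<and> u < v)}. f u v) \<le> 1 + ln D"
      by (simp add: J_def)
  qed
  also have "\<dots> \<le> real (card V) * (1 + ln D)"
  proof -
    have "card (good X) \<le> card V"
      using finV by (intro card_mono) (auto simp: good_def)
    then show ?thesis using D by (auto intro!: mult_right_mono)
  qed
  finally show ?thesis .
qed

text \<open>Incidences between A and X, counted from the side of X.\<close>

lemma sum_card_nbrs_le:
  assumes "X \<subseteq> V" "finite A"
  shows "(\<Sum>v\<in>A. real (card (nbrs E v \<inter> X))) \<le> real (card X) * D"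
proof -
  have finX: "finite X" using assms finV finite_subset by blast
  have "(\<Sum>v\<in>A. real (card (nbrs E v \<inter> X))) = (\<Sum>v\<in>A. \<Sum>x\<in>{x. x \<in> X \<and> x \<in> nbrs E v}. 1)"
    by (intro sum.cong refl) (auto intro!: arg_cong[where f = card])
  also have "\<dots> = (\<Sum>x\<in>X. \<Sum>v\<in>{v. v \<in> A \<and> x \<in> nbrs E v}. 1)"
    by (rule sum.swap_restrict[OF assms(2) finX])
  also have "\<dots> \<le> (\<Sum>x\<in>X. D)"
  proof (rule sum_mono)
    fix x assume "x \<in> X"
    have "card {v. v \<in> A \<and> x \<in> nbrs E v} \<le> card (nbrs E x)"
      by (intro card_mono fin_nbrs) (auto simp: in_nbrs_commute)
    then show "(\<Sum>v\<in>{v. v \<in> A \<and> x \<in> nbrs E v}. 1) \<le> D"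
      using deg_le[of x] \<open>x \<in> X\<close> assms(1) by (auto simp: degree_eq_card_nbrs[OF E])
  qed
  finally show ?thesis by simp
qed

text \<open>A vertex outside S and X that is not good sends more than a quarter of its degree to X,
  while X receives at most \<open>card X * D\<close> such edges in all.\<close>

lemma card_not_good_le:
  assumes X: "X \<subseteq> V - S"
  shows "real (card (V - good X)) \<le> real (card S) + real (card X) * (1 + 4 / \<gamma>)"
proof -
  define B where "B = V - S - X - good X"
  have finX: "finite X" using X finV finite_subset by blast
  have "real (card B) * (\<gamma> * D / 4) = (\<Sum>v\<in>B. \<gamma> * D / 4)" by simp
  also have "\<dots> \<le> (\<Sum>v\<in>B. real (card (nbrs E v \<inter> X)))"
  proof (rule sum_mono)
    fix v assume "v \<in> B"
    then have "v \<in> V" "degree E v < 4 * card (nbrs E v \<inter> X)" by (auto simp: B_def good_def)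
    then show "\<gamma> * D / 4 \<le> real (card (nbrs E v \<inter> X))"
      using deg_ge[of v] by linarith
  qed
  also have "\<dots> \<le> real (card X) * D"
    using X finV by (intro sum_card_nbrs_le) (auto simp: B_def)
  finally have B: "real (card B) \<le> real (card X) * (4 / \<gamma>)"
    using D \<gamma> by (simp add: field_simps)
  have "V - good X \<subseteq> S \<union> (X \<union> B)" by (auto simp: B_def)
  then have "card (V - good X) \<le> card (S \<union> (X \<union> B))"
    using finX finV finS by (intro card_mono) (auto simp: B_def)
  also have "\<dots> \<le> card S + (card X + card B)"
    by (meson card_Un_le add_left_mono order_trans)
  finally show ?thesis using B by (simp add: algebra_simps)
qed

text \<open>Both deficits are at most a quarter of the degree, so y is at most 1/2, where 1 - y is
  at least exp (-2 y). In this form the deficits of all vertices add up in one exponent.\<close>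

lemma pivot_ge:
  assumes X: "X \<subseteq> V - S" and v: "v \<in> good X"
  defines "y \<equiv> (real (card (nbrs E v \<inter> X)) + loss X v) / real (degree E v)"
  shows "real (degree E v) * exp (- 2 * y) \<le> pivot X v"
proof -
  have d: "0 < real (degree E v)" using v by (intro deg_pos) (auto simp: good_def)
  have "real (card (nbrs E v \<inter> X)) + loss X v \<le> real (degree E v) / 2"
    using loss_le[OF X, of v] v by (auto simp: good_def)
  then have y: "0 \<le> y" "y \<le> 1 / 2"
    using d loss_nonneg[of X v] by (auto simp: y_def field_simps)
  have "y\<^sup>2 \<le> y / 2"
    using y mult_left_mono[of y "1/2" y] by (simp add: power2_eq_square)
  then have "- 2 * y \<le> ln (1 - y)"
    using ln_one_minus_pos_lower_bound[OF y] by linarith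
  then have "exp (- 2 * y) \<le> 1 - y"
    using y by (subst ln_ge_iff[symmetric]) auto
  then have "real (degree E v) * exp (- 2 * y) \<le> real (degree E v) * (1 - y)"
    using d by (intro mult_left_mono) auto
  also have "\<dots> = pivot X v"
    using d by (simp add: y_def pivot_def field_simps)
  finally show ?thesis .
qed

end

text \<open>The matrix is the graph Laplacian of H with the vertices outside U grounded;
  \<open>c e\<close> is the signed incidence vector of e.\<close>

lemma sum_sqdiff_eq_quadratic_form:
  assumes "finite H" "finite U"
  defines "c \<equiv> \<lambda>e i. of_bool (i = Min e) - of_bool (i = Max e) :: real"
  shows "(\<Sum>e\<in>H. sqdiff (extend U x) e) = (\<Sum>i\<in>U. \<Sum>j\<in>U. (\<Sum>e\<in>H. c e i * c e j) * x i * x j)"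
proof -
  have "(\<Sum>i\<in>U. of_bool (i = w) * x i) = extend U x w" for w
    using assms(2) by (simp add: extend_def of_bool_def if_distrib[of "\<lambda>a. a * _"] cong: if_cong)
  then have "extend U x (Min e) - extend U x (Max e) = (\<Sum>i\<in>U. c e i * x i)" for e
    by (simp add: c_def left_diff_distrib sum_subtractf)
  then have "(\<Sum>e\<in>H. sqdiff (extend U x) e) = (\<Sum>e\<in>H. \<Sum>i\<in>U. \<Sum>j\<in>U. c e i * c e j * x i * x j)"
    by (simp add: sqdiff_def power2_eq_square sum_product algebra_simps)
  also have "\<dots> = (\<Sum>i\<in>U. \<Sum>e\<in>H. \<Sum>j\<in>U. c e i * c e j * x i * x j)"
    by (rule sum.swap)
  also have "\<dots> = (\<Sum>i\<in>U. \<Sum>j\<in>U. \<Sum>e\<in>H. c e i * c e j * x i * x j)"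
    by (intro sum.cong refl sum.swap)
  finally show ?thesis by (simp add: sum_distrib_right)
qed

section \<open>Upper bound for orientations balanced outside the pinned set\<close>

context pinned_graph
begin

lemma pivot_pos:
  assumes "X \<subseteq> V - S" "v \<in> good X"
  shows "0 < pivot X v"
proof -
  have "0 < real (degree E v)" using assms by (intro deg_pos) (auto simp: good_def)
  then show ?thesis using pivot_ge[OF assms] by (smt (verit) exp_gt_zero mult_pos_pos)
qed

lemma gaussian_graph_integral_le_pivots:
  assumes X: "X \<subseteq> V - S"
  shows "(\<integral>\<^sup>+x. ennreal (exp (- (\<Sum>e | e \<in> E \<and> e \<inter> X = {}. sqdiff (extend (V - S) x) e) / 2))
             \<partial>Pi\<^sub>M (V - S) (\<lambda>_. angle_measure))
           \<le> ennreal (\<Prod>v\<in>good X. sqrt (2 / (pi * pivot X v)))"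
proof -
  let ?H = "{e. e \<in> E \<and> e \<inter> X = {}}"
  have finH: "finite ?H" and finU: "finite (V - S)" using finE finV by auto
  note quad = sum_sqdiff_eq_quadratic_form[OF finH finU, symmetric]
  show ?thesis
    unfolding sum_sqdiff_eq_quadratic_form[OF finH finU]
  proof (rule gaussian_angles_integral_le)
    show "pivot X v \<le> (\<Sum>i\<in>V - S. \<Sum>j\<in>V - S.
        (\<Sum>e\<in>?H. (of_bool (i = Min e) - of_bool (i = Max e)) * (of_bool (j = Min e) - of_bool (j = Max e))) * x i * x j)"
      if v: "v \<in> good X" and x: "x v = 1"
        and x0: "\<And>w. w \<in> V - S \<Longrightarrow> \<not> (w \<in> good X \<and> w \<le> v) \<Longrightarrow> x w = 0" for v x
      unfolding quad
      using v x x0 good_subset[of X] by (intro pivot_le[OF X v]) (auto simp: extend_def)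
    show "0 \<le> (\<Sum>i\<in>V - S. \<Sum>j\<in>V - S.
        (\<Sum>e\<in>?H. (of_bool (i = Min e) - of_bool (i = Max e)) * (of_bool (j = Min e) - of_bool (j = Max e))) * x i * x j)" for x :: "nat \<Rightarrow> real"
      unfolding quad by (rule sum_nonneg) simp
  qed (use X finU fin_good good_subset pivot_pos[OF X] in \<open>simp_all add: mult.commute\<close>)
qed

text \<open>Passing from pivots to degrees costs \<open>exp (y v)\<close> at each good vertex.
  Vertices that are not good carry no Gaussian factor; inserting one costs at most D each, and
  \<open>card_not_good_le\<close> counts them.\<close>

lemma prod_pivots_le:
  assumes X: "X \<subseteq> V - S"
  shows "(\<Prod>v\<in>good X. sqrt (2 / (pi * pivot X v)))
           \<le> (\<Prod>v\<in>V. sqrt (2 / (pi * real (degree E v)))) *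
              exp (real (card S) * ln D + real (card X) * ((1 + 4 / \<gamma>) * ln D + 1 / \<gamma>)
                   + real (card V) * (1 + ln D) / (\<gamma> * D))"
proof -
  define y where "y v = (real (card (nbrs E v \<inter> X)) + loss X v) / real (degree E v)" for v
  define g where "g v = sqrt (2 / (pi * real (degree E v)))" for v
  have gpos: "g v > 0" if "v \<in> V" for v
    using deg_pos[OF that] by (simp add: g_def)
  have gD: "1 \<le> g v * D" if v: "v \<in> V" for v
  proof -
    have "pi * real (degree E v) \<le> 4 * D"
      using deg_le[OF v] pi_less_4 by (intro mult_mono) auto
    also have "\<dots> \<le> 2 * D\<^sup>2"
      using D by (simp add: power2_eq_square)
    finally have "1 \<le> 2 / (pi * real (degree E v)) * D\<^sup>2"
      using deg_pos[OF v] by (simp add: field_simps)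
    then have "1 \<le> sqrt (2 / (pi * real (degree E v)) * D\<^sup>2)" by simp
    also have "\<dots> = g v * D"
      unfolding real_sqrt_mult g_def using D by simp
    finally show ?thesis .
  qed
  have "(\<Prod>v\<in>good X. sqrt (2 / (pi * pivot X v))) \<le> (\<Prod>v\<in>good X. g v * exp (y v))"
  proof (intro prod_mono conjI)
    fix v assume v: "v \<in> good X"
    have dp: "0 < real (degree E v)" using v by (intro deg_pos) (auto simp: good_def)
    have "2 / (pi * pivot X v) \<le> 2 / (pi * (real (degree E v) * exp (- 2 * y v)))"
      using pivot_ge[OF X v] pivot_pos[OF X v] dp unfolding y_def
      by (intro divide_left_mono mult_left_mono mult_pos_pos) auto
    also have "\<dots> = 2 / (pi * real (degree E v)) * (exp (y v))\<^sup>2"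
      by (simp add: exp_minus power2_eq_square exp_add[symmetric] field_simps)
    finally have "sqrt (2 / (pi * pivot X v)) \<le> sqrt (2 / (pi * real (degree E v)) * (exp (y v))\<^sup>2)"
      by (rule real_sqrt_le_mono)
    also have "\<dots> = g v * exp (y v)"
      by (subst real_sqrt_mult) (simp add: g_def)
    finally show "sqrt (2 / (pi * pivot X v)) \<le> g v * exp (y v)" .
    show "0 \<le> sqrt (2 / (pi * pivot X v))"
      using pivot_pos[OF X v] by (simp add: less_imp_le)
  qed
  also have "\<dots> = (\<Prod>v\<in>good X. g v) * exp (\<Sum>v\<in>good X. y v)"
    by (simp add: prod.distrib exp_sum fin_good)
  also have "\<dots> \<le> ((\<Prod>v\<in>V. g v) * exp ((real (card S) + real (card X) * (1 + 4 / \<gamma>)) * ln D))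
      * exp ((real (card X) * D + real (card V) * (1 + ln D)) / (\<gamma> * D))"
  proof (rule mult_mono)
    have "(\<Prod>v\<in>good X. g v) \<le> (\<Prod>v\<in>good X. g v) * (\<Prod>v\<in>V - good X. g v * D)"
    proof -
      have "1 \<le> (\<Prod>v\<in>V - good X. g v * D)"
        using gD by (intro prod_ge_1) auto
      moreover have "0 \<le> (\<Prod>v\<in>good X. g v)"
        using gpos good_subset by (intro prod_nonneg) (auto intro!: less_imp_le gpos simp: good_def)
      ultimately show ?thesis
        using mult_left_mono by fastforce
    qed
    also have "\<dots> = (\<Prod>v\<in>V. g v) * D ^ card (V - good X)"
    proof -
      have "(\<Prod>v\<in>V. g v) = (\<Prod>v\<in>V - good X. g v) * (\<Prod>v\<in>good X. g v)"
        using finV good_subset by (intro prod.subset_diff) (auto simp: good_def)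
      then show ?thesis by (simp add: prod.distrib)
    qed
    also have "D ^ card (V - good X) = exp (real (card (V - good X)) * ln D)"
      using D by (simp add: exp_of_nat_mult)
    also have "(\<Prod>v\<in>V. g v) * exp (real (card (V - good X)) * ln D)
        \<le> (\<Prod>v\<in>V. g v) * exp ((real (card S) + real (card X) * (1 + 4 / \<gamma>)) * ln D)"
    proof (rule mult_left_mono)
      show "exp (real (card (V - good X)) * ln D) \<le> exp ((real (card S) + real (card X) * (1 + 4 / \<gamma>)) * ln D)"
        using card_not_good_le[OF X] D by (auto intro!: mult_right_mono)
      show "0 \<le> (\<Prod>v\<in>V. g v)"
        using gpos by (auto intro!: prod_nonneg intro: less_imp_le)
    qed
    finally show "(\<Prod>v\<in>good X. g v) \<le> (\<Prod>v\<in>V. g v) * exp ((real (card S) + real (card X) * (1 + 4 / \<gamma>)) * ln D)" .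
    \<comment> \<open>The edges into X give \<open>1 / \<gamma>\<close> per element of X, and the
      series losses give the last term of the exponent.\<close>
    have "(\<Sum>v\<in>good X. y v) \<le> (\<Sum>v\<in>good X. (real (card (nbrs E v \<inter> X)) + loss X v) / (\<gamma> * D))"
    proof (rule sum_mono)
      fix v assume "v \<in> good X"
      then have "v \<in> V" by (simp add: good_def)
      then show "y v \<le> (real (card (nbrs E v \<inter> X)) + loss X v) / (\<gamma> * D)"
        unfolding y_def using deg_ge[of v] deg_pos[of v] D \<gamma> loss_nonneg[of X v]
        by (intro divide_left_mono mult_pos_pos add_nonneg_nonneg) auto
    qed
    also have "\<dots> = ((\<Sum>v\<in>good X. real (card (nbrs E v \<inter> X))) + (\<Sum>v\<in>good X. loss X v)) / (\<gamma> * D)"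
      by (simp only: sum_divide_distrib[symmetric] sum.distrib)
    also have "\<dots> \<le> (real (card X) * D + real (card V) * (1 + ln D)) / (\<gamma> * D)"
      using X D \<gamma> fin_good by (intro divide_right_mono add_mono sum_card_nbrs_le sum_loss_le) auto
    finally show "exp (\<Sum>v\<in>good X. y v) \<le> exp ((real (card X) * D + real (card V) * (1 + ln D)) / (\<gamma> * D))"
      by simp
  qed (use gpos in \<open>auto intro!: prod_nonneg mult_nonneg_nonneg intro: less_imp_le\<close>)
  also have "\<dots> = (\<Prod>v\<in>V. g v) *
              exp (real (card S) * ln D + real (card X) * ((1 + 4 / \<gamma>) * ln D + 1 / \<gamma>)
                   + real (card V) * (1 + ln D) / (\<gamma> * D))"
  proof -
    have "(real (card X) * D + real (card V) * (1 + ln D)) / (\<gamma> * D)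
        = real (card X) * (1 / \<gamma>) + real (card V) * (1 + ln D) / (\<gamma> * D)"
      using D \<gamma> by (simp add: add_divide_distrib)
    then show ?thesis
      by (simp only: mult.assoc exp_add[symmetric]) (simp add: algebra_simps)
  qed
  finally show ?thesis unfolding g_def .
qed

text \<open>X and S are disjoint, so edges to S from different vertices of X are different.\<close>

lemma card_edges_outlier_pinned:
  assumes "X \<subseteq> V - S"
  shows "k * real (card X) \<le> real (card {e \<in> E. e \<inter> X \<noteq> {} \<and> e \<inter> S \<noteq> {}})"
proof -
  have finX: "finite X" using assms finV finite_subset by blast
  define P where "P v = (\<lambda>s. {v, s}) ` (nbrs E v \<inter> S)" for v
  have cP: "card (P v) = card (nbrs E v \<inter> S)" for v
    unfolding P_def by (rule card_image) (auto simp: inj_on_def doubleton_eq_iff)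
  have "k * real (card X) = (\<Sum>v\<in>X. k)" by simp
  also have "\<dots> \<le> (\<Sum>v\<in>X. real (card (P v)))"
    unfolding cP using pinned assms by (intro sum_mono) auto
  also have "\<dots> = real (card (\<Union>v\<in>X. P v))"
  proof -
    have "P u \<inter> P v = {}" if "u \<in> X" "v \<in> X" "u \<noteq> v" for u v
      using that assms by (auto simp: P_def doubleton_eq_iff)
    then show ?thesis
      using finX fin_nbrs by (subst card_UN_disjoint) (auto simp: P_def)
  qed
  also have "\<dots> \<le> real (card {e \<in> E. e \<inter> X \<noteq> {} \<and> e \<inter> S \<noteq> {}})"
    using finE by (intro of_nat_mono card_mono) (auto simp: P_def nbrs_def)
  finally show ?thesis .
qed

text \<open>Edges avoiding X have angle difference at most pi/2 and get the Gaussian bound, edges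
  between X and S get 1 / sqrt 2, and all others the trivial bound 1.\<close>

lemma prod_cos_le:
  assumes x: "\<And>v. v \<in> V - S \<Longrightarrow> \<bar>x v\<bar> \<le> pi / 2"
  defines "X \<equiv> {v \<in> V - S. pi / 4 < \<bar>x v\<bar>}"
  shows "\<bar>\<Prod>e\<in>E. cos (extend (V - S) x (Min e) - extend (V - S) x (Max e))\<bar>
     \<le> exp (- (k * (ln 2 / 2)) * real (card X)) * exp (- (\<Sum>e | e \<in> E \<and> e \<inter> X = {}. sqdiff (extend (V - S) x) e) / 2)"
proof -
  define y where "y = extend (V - S) x"
  define C where "C = {e \<in> E. e \<inter> X \<noteq> {} \<and> e \<inter> S \<noteq> {}}"
  define H where "H = {e. e \<in> E \<and> e \<inter> X = {}}"
  have y_small: "\<bar>y v\<bar> \<le> pi / 4" if "v \<in> V" "v \<notin> X" for v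
    using that by (auto simp: y_def extend_def X_def)
  have cos_y: "\<bar>cos (y (Min e) - y (Max e))\<bar>
      \<le> (if e \<in> H then exp (- sqdiff y e / 2) else 1) * (if e \<in> C then 1 / sqrt 2 else 1)" if "e \<in> E" for e
  proof -
    have e: "e = {Min e, Max e}" "Min e \<in> V" "Max e \<in> V" "Min e \<noteq> Max e"
      using nsets_2_Min_Max[of e V] that E by auto
    consider "e \<in> H" | "e \<in> C" | "e \<notin> H" "e \<notin> C" by blast
    then show ?thesis
    proof cases
      case 1
      then have "e \<notin> C" "Min e \<notin> X" "Max e \<notin> X" using e(1) by (auto simp: H_def C_def)
      then have "\<bar>y (Min e) - y (Max e)\<bar> \<le> pi / 2"
        using y_small[of "Min e"] y_small[of "Max e"] e by linarith
      moreover from this have "0 \<le> cos (y (Min e) - y (Max e))"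
        by (intro cos_ge_zero) linarith+
      ultimately show ?thesis
        using 1 \<open>e \<notin> C\<close> cos_le_exp_neg_half_square[of "y (Min e) - y (Max e)"]
        by (simp add: sqdiff_def)
    next
      case 2
      then have nH: "e \<notin> H" by (auto simp: H_def C_def)
      obtain u s where us: "u \<in> e" "u \<in> X" "s \<in> e" "s \<in> S"
        using 2 by (auto simp: C_def)
      have "u \<noteq> s" using us by (auto simp: X_def)
      then have "{Min e, Max e} = {u, s}"
        using us e(1) by (metis doubleton_eq_iff insertE singletonD)
      then have "\<bar>cos (y (Min e) - y (Max e))\<bar> = \<bar>cos (y u - y s)\<bar>"
        by (auto simp: doubleton_eq_iff) (metis cos_minus minus_diff_eq)
      also have "y s = 0" using us by (simp add: y_def extend_def)
      also have "\<bar>cos (y u - 0)\<bar> \<le> 1 / sqrt 2"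
        using us x[of u] cos_le_inverse_sqrt2[of "y u"] by (auto simp: X_def y_def extend_def)
      finally show ?thesis using 2 nH by simp
    next
      case 3
      then show ?thesis by simp
    qed
  qed
  have finC: "finite C" and finH: "finite H" using finE by (auto simp: C_def H_def)
  have sub: "C \<subseteq> E" "H \<subseteq> E" by (auto simp: C_def H_def)
  have "\<bar>\<Prod>e\<in>E. cos (y (Min e) - y (Max e))\<bar>
      \<le> (\<Prod>e\<in>E. (if e \<in> H then exp (- sqdiff y e / 2) else 1) * (if e \<in> C then 1 / sqrt 2 else 1))"
    unfolding abs_prod using cos_y by (intro prod_mono) auto
  also have "\<dots> = (\<Prod>e\<in>H. exp (- sqdiff y e / 2)) * (\<Prod>e\<in>C. 1 / sqrt 2)"
    unfolding prod.distrib using finE sub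
    by (simp add: prod.inter_restrict[symmetric] Int_absorb1 Int_absorb2)
  also have "(\<Prod>e\<in>H. exp (- sqdiff y e / 2)) = exp (- (\<Sum>e\<in>H. sqdiff y e) / 2)"
    using finH by (simp add: exp_sum[symmetric] sum_negf sum_divide_distrib)
  also have "(\<Prod>e\<in>C. 1 / sqrt 2) = exp (- (ln 2 / 2) * real (card C))"
  proof -
    have "exp (- (ln 2 / 2) * real (card C)) = exp (- (ln 2 / 2)) ^ card C"
      by (metis exp_of_nat_mult mult.commute)
    also have "exp (- (ln 2 / 2)) = 1 / sqrt (2 :: real)"
      by (simp add: exp_minus ln_sqrt[symmetric] inverse_eq_divide)
    finally show ?thesis by simp
  qed
  also have "\<dots> \<le> exp (- (k * (ln 2 / 2)) * real (card X))"
  proof -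
    have "k * real (card X) \<le> real (card C)"
      unfolding C_def by (rule card_edges_outlier_pinned) (auto simp: X_def)
    then have "(k * real (card X)) * (ln 2 / 2) \<le> real (card C) * (ln 2 / 2)"
      by (intro mult_right_mono) auto
    then show ?thesis by (simp add: mult_ac)
  qed
  finally show ?thesis
    unfolding y_def H_def by (simp add: mult.commute)
qed

end

context pinned_graph
begin

text \<open>The integrand is bounded according to the set X of outliers. Each outlier costs a factor
  r of at most 1/D, so the sum over all X is at most (1 + 1/D)^|U|.\<close>

lemma card_balanced_le:
  assumes even: "\<And>v. v \<in> V \<Longrightarrow> even (degree E v)"
  shows "real (card {F \<in> Pow E. \<forall>v\<in>V - S. excess E F v = 0})
     \<le> 2 ^ card E * ((\<Prod>v\<in>V. sqrt (2 / (pi * real (degree E v)))) *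
         exp (real (card S) * ln D + real (card V) * (1 + ln D) / (\<gamma> * D) + real (card V) / D))"
proof -
  define U where "U = V - S"
  define M where "M = Pi\<^sub>M U (\<lambda>_. angle_measure)"
  define f where "f x = (\<Prod>e\<in>E. cos (extend U x (Min e) - extend U x (Max e)))" for x
  define a where "a X = exp (- (k * (ln 2 / 2)) * real (card X))" for X :: "nat set"
  define h where "h X x = exp (- (\<Sum>e | e \<in> E \<and> e \<inter> X = {}. sqdiff (extend U x) e) / 2)" for X x
  define P where "P = (\<Prod>v\<in>V. sqrt (2 / (pi * real (degree E v))))"
  define R where "R = real (card S) * ln D + real (card V) * (1 + ln D) / (\<gamma> * D)"
  \<comment> \<open>Net factor per outlier: the gain on pinned edges against the loss in
    \<open>prod_pivots_le\<close>.\<close>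
  define r where "r = exp (- (k * (ln 2 / 2)) + ((1 + 4 / \<gamma>) * ln D + 1 / \<gamma>))"
  have finU: "finite U" using finV by (simp add: U_def)
  have P0: "0 \<le> P" unfolding P_def by (intro prod_nonneg) simp
  interpret M: prob_space M
    unfolding M_def by (rule prob_space_PiM) (rule angle.prob_space_axioms)
  have [measurable]: "f \<in> borel_measurable M" "h X \<in> borel_measurable M" for X
    unfolding f_def h_def M_def sqdiff_def by measurable
  have f1: "\<bar>f x\<bar> \<le> 1" for x
    unfolding f_def abs_prod by (intro prod_le_1) auto
  have int: "integrable M f"
    using f1 by (intro M.integrable_const_bound[of _ 1]) auto
  have "ennreal (LINT x|M. f x) \<le> ennreal (LINT x|M. \<bar>f x\<bar>)"
    using int by (intro ennreal_leI integral_mono) auto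
  also have "\<dots> = (\<integral>\<^sup>+x. ennreal \<bar>f x\<bar> \<partial>M)"
    using int by (intro nn_integral_eq_integral[symmetric]) auto
  also have "\<dots> \<le> (\<integral>\<^sup>+x. (\<Sum>X\<in>Pow U. ennreal (a X) * ennreal (h X x)) \<partial>M)"
  proof (rule nn_integral_mono_AE)
    have "AE x in M. \<forall>v\<in>U. \<bar>x v\<bar> \<le> pi / 2"
      unfolding M_def by (rule AE_angles[OF finU])
    then show "AE x in M. ennreal \<bar>f x\<bar> \<le> (\<Sum>X\<in>Pow U. ennreal (a X) * ennreal (h X x))"
    proof eventually_elim
      case (elim x)
      define X where "X = {v \<in> U. pi / 4 < \<bar>x v\<bar>}"
      have "\<bar>f x\<bar> \<le> a X * h X x"
        using prod_cos_le[of x] elim unfolding f_def a_def h_def X_def U_def by simp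
      then have "ennreal \<bar>f x\<bar> \<le> ennreal (a X) * ennreal (h X x)"
        by (simp add: ennreal_mult[symmetric] a_def h_def)
      \<comment> \<open>Adding the terms of all other sets gives a finite sum of Gaussians, each
        integrable over the whole domain.\<close>
      also have "\<dots> \<le> (\<Sum>X\<in>Pow U. ennreal (a X) * ennreal (h X x))"
        using finU by (intro member_le_sum) (auto simp: X_def)
      finally show ?case .
    qed
  qed
  also have "\<dots> = (\<Sum>X\<in>Pow U. ennreal (a X) * (\<integral>\<^sup>+x. ennreal (h X x) \<partial>M))"
    by (simp add: nn_integral_sum nn_integral_cmult)
  also have "\<dots> \<le> (\<Sum>X\<in>Pow U. ennreal (P * exp R * r ^ card X))"
  proof (rule sum_mono)
    fix X assume "X \<in> Pow U"
    then have X: "X \<subseteq> V - S" by (auto simp: U_def)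
    have "(\<integral>\<^sup>+x. ennreal (h X x) \<partial>M) \<le> ennreal (\<Prod>v\<in>good X. sqrt (2 / (pi * pivot X v)))"
      unfolding M_def h_def U_def by (rule gaussian_graph_integral_le_pivots[OF X])
    also have "\<dots> \<le> ennreal (P * exp (R + real (card X) * ((1 + 4 / \<gamma>) * ln D + 1 / \<gamma>)))"
      using prod_pivots_le[OF X] by (intro ennreal_leI) (simp add: P_def R_def algebra_simps)
    finally have "ennreal (a X) * (\<integral>\<^sup>+x. ennreal (h X x) \<partial>M)
        \<le> ennreal (a X) * ennreal (P * exp (R + real (card X) * ((1 + 4 / \<gamma>) * ln D + 1 / \<gamma>)))"
      by (rule mult_left_mono) simp
    also have "\<dots> = ennreal (P * exp R * r ^ card X)"
    proof -
      have "r ^ card X = a X * exp (real (card X) * ((1 + 4 / \<gamma>) * ln D + 1 / \<gamma>))"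
        unfolding r_def a_def exp_of_nat_mult[symmetric] exp_add[symmetric] by (simp add: algebra_simps)
      then show ?thesis
        using P0 by (simp add: ennreal_mult[symmetric] a_def exp_add mult_ac)
    qed
    finally show "ennreal (a X) * (\<integral>\<^sup>+x. ennreal (h X x) \<partial>M) \<le> ennreal (P * exp R * r ^ card X)" .
  qed
  also have "\<dots> = ennreal (P * exp R * (\<Sum>X\<in>Pow U. r ^ card X))"
    using P0 by (simp add: sum_ennreal r_def sum_distrib_left)
  finally have "(LINT x|M. f x) \<le> P * exp R * (\<Sum>X\<in>Pow U. r ^ card X)"
    using P0 by (subst (asm) ennreal_le_iff) (auto intro!: mult_nonneg_nonneg sum_nonneg simp: r_def)
  also have "(\<Sum>X\<in>Pow U. r ^ card X) = (r + 1) ^ card U"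
    using prod_add[OF finU, of "\<lambda>_. r" "\<lambda>_. 1"] by simp
  also have "P * exp R * (r + 1) ^ card U \<le> P * exp R * exp (real (card V) / D)"
  proof (intro mult_left_mono)
    \<comment> \<open>This is where the spare \<open>ln D\<close> in \<open>k_large\<close> is
      spent.\<close>
    have "r \<le> exp (- ln D)"
      unfolding r_def using k_large by (simp add: algebra_simps)
    then have "r \<le> 1 / D" using D by (simp add: exp_minus inverse_eq_divide)
    moreover have "1 + 1 / D \<le> exp (1 / D)" by (rule exp_ge_add_one_self)
    ultimately have "r + 1 \<le> exp (1 / D)" by linarith
    then have "(r + 1) ^ card U \<le> exp (1 / D) ^ card U"
      by (intro power_mono) (simp_all add: r_def)
    also have "\<dots> \<le> exp (1 / D) ^ card V"
      using finV D by (intro power_increasing card_mono) (auto simp: U_def)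
    also have "\<dots> = exp (real (card V) / D)"
      unfolding exp_of_nat_mult[symmetric] by simp
    finally show "(r + 1) ^ card U \<le> exp (real (card V) / D)" .
  qed (use P0 in auto)
  finally have "(LINT x|M. f x) \<le> P * exp (R + real (card V) / D)"
    by (simp add: exp_add mult.assoc)
  moreover have "real (card {F \<in> Pow E. \<forall>v\<in>U. excess E F v = 0}) = 2 ^ card E * (LINT x|M. f x)"
    unfolding M_def f_def using even by (intro card_balanced_eq_integral[OF finV E]) (auto simp: U_def)
  ultimately show ?thesis
    unfolding U_def P_def R_def by (simp add: mult_left_mono)
qed

end

text \<open>A random subset of density \<open>p\<close>, enlarged by the vertices with fewer than \<open>k\<close> neighbours in it.\<close>

lemma exists_pinning_set:
  fixes k p \<delta> :: real
  assumes finV: "finite V" and E: "E \<subseteq> nsets V 2" and p: "0 \<le> p" "p \<le> 1"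
    and deg: "\<And>v. v \<in> V \<Longrightarrow> \<delta> \<le> real (degree E v)"
  shows "\<exists>S\<subseteq>V. real (card S) \<le> real (card V) * (p + 2 powr k * exp (- p * \<delta> / 2)) \<and>
           (\<forall>v\<in>V - S. k \<le> real (card (nbrs E v \<inter> S)))"
proof -
  \<comment> \<open>The probability that the random subset of density p equals X.\<close>
  define w where "w X = (\<Prod>u\<in>X. p) * (\<Prod>u\<in>V - X. 1 - p)" for X :: "nat set"
  define bad where "bad X = {v \<in> V. real (card (nbrs E v \<inter> X)) < k}" for X
  define f where "f X = real (card X) + real (card (bad X))" for X
  define b where "b = real (card V) * (p + 2 powr k * exp (- p * \<delta> / 2))"
  have w0: "0 \<le> w X" for X
    unfolding w_def using p by (intro mult_nonneg_nonneg prod_nonneg) auto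
  have w1: "(\<Sum>X\<in>Pow V. w X) = 1"
    using prod_add[OF finV, of "\<lambda>_. p" "\<lambda>_. 1 - p"] by (simp add: w_def)
  have mem: "(\<Sum>X\<in>Pow V. w X * of_bool (v \<in> X)) = p" if v: "v \<in> V" for v
  proof -
    \<comment> \<open>A zero factor at v removes exactly the sets that omit v.\<close>
    have "(\<Sum>X\<in>Pow V. w X * of_bool (v \<in> X))
        = (\<Sum>X\<in>Pow V. (\<Prod>u\<in>X. p) * (\<Prod>u\<in>V - X. if u = v then 0 else 1 - p))"
    proof (intro sum.cong refl)
      fix X assume "X \<in> Pow V"
      have "(\<Prod>u\<in>V - X. if u = v then 0 else 1 - p) = of_bool (v \<in> X) * (\<Prod>u\<in>V - X. 1 - p)"
      proof (cases "v \<in> X")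
        case True
        then have "(\<Prod>u\<in>V - X. if u = v then 0 else 1 - p) = (\<Prod>u\<in>V - X. 1 - p)"
          by (intro prod.cong) auto
        then show ?thesis using True by simp
      next
        case False
        then show ?thesis using v finV by (auto intro!: prod_zero)
      qed
      then show "w X * of_bool (v \<in> X) = (\<Prod>u\<in>X. p) * (\<Prod>u\<in>V - X. if u = v then 0 else 1 - p)"
        by (simp add: w_def)
    qed
    also have "\<dots> = (\<Prod>u\<in>V. p + (if u = v then 0 else 1 - p))"
      by (rule prod_add[OF finV, symmetric])
    also have "\<dots> = (\<Prod>u\<in>V. if u = v then p else 1)"
      by (intro prod.cong) auto
    finally show ?thesis using v finV by simp
  qed
  \<comment> \<open>Exponential moment bound: the indicator of fewer than k neighbours in X is at
    most \<open>2 powr (k - real (card (nbrs E v \<inter> X)))\<close>, whose mean factors over the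
    vertices with \<open>1 - p / 2\<close> at each neighbour.\<close>
  have few: "(\<Sum>X\<in>Pow V. w X * of_bool (v \<in> bad X)) \<le> 2 powr k * exp (- p * \<delta> / 2)" if v: "v \<in> V" for v
  proof -
    let ?h = "\<lambda>u. if u \<in> nbrs E v then 1 / 2 else 1 :: real"
    have N: "nbrs E v \<subseteq> V" using nbrs_subset[OF E] by blast
    have "(\<Sum>X\<in>Pow V. w X * of_bool (v \<in> bad X))
        \<le> (\<Sum>X\<in>Pow V. 2 powr k * ((\<Prod>u\<in>X. p * ?h u) * (\<Prod>u\<in>V - X. 1 - p)))"
    proof (rule sum_mono)
      fix X assume "X \<in> Pow V"
      then have finX: "finite X" using finV finite_subset by blast
      have "(\<Prod>u\<in>X. ?h u) = (1 / 2) ^ card (nbrs E v \<inter> X)"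
        using finX by (simp add: prod.inter_restrict[symmetric] Int_commute)
      also have "\<dots> = 2 powr (- real (card (nbrs E v \<inter> X)))"
        by (simp add: powr_minus powr_realpow power_one_over inverse_eq_divide)
      finally have h: "2 powr k * (\<Prod>u\<in>X. ?h u) = 2 powr (k - real (card (nbrs E v \<inter> X)))"
        by (simp add: powr_add[symmetric])
      have "of_bool (v \<in> bad X) \<le> 2 powr k * (\<Prod>u\<in>X. ?h u)"
        unfolding h by (auto simp: bad_def intro!: ge_one_powr_ge_zero)
      then have "w X * of_bool (v \<in> bad X) \<le> w X * (2 powr k * (\<Prod>u\<in>X. ?h u))"
        by (rule mult_left_mono) (rule w0)
      also have "\<dots> = 2 powr k * ((\<Prod>u\<in>X. p * ?h u) * (\<Prod>u\<in>V - X. 1 - p))"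
        unfolding prod.distrib w_def by (simp only: mult_ac)
      finally show "w X * of_bool (v \<in> bad X) \<le> 2 powr k * ((\<Prod>u\<in>X. p * ?h u) * (\<Prod>u\<in>V - X. 1 - p))" .
    qed
    also have "\<dots> = 2 powr k * (\<Prod>u\<in>V. p * ?h u + (1 - p))"
      unfolding prod_add[OF finV] by (simp add: sum_distrib_left)
    also have "(\<Prod>u\<in>V. p * ?h u + (1 - p)) = (\<Prod>u\<in>V. if u \<in> nbrs E v then 1 - p / 2 else 1)"
      by (intro prod.cong) auto
    also have "\<dots> = (1 - p / 2) ^ degree E v"
      using finV N by (simp add: prod.inter_restrict[symmetric] Int_absorb1 degree_eq_card_nbrs[OF E])
    also have "\<dots> \<le> exp (- p / 2) ^ degree E v"
      using p exp_ge_add_one_self[of "- p / 2"] by (intro power_mono) auto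
    also have "\<dots> = exp (- p / 2 * real (degree E v))"
      by (simp only: exp_of_nat_mult[symmetric] mult.commute)
    also have "\<dots> \<le> exp (- p * \<delta> / 2)"
      using mult_left_mono[OF deg[OF v], of p] p by simp
    finally show ?thesis by simp
  qed
  have "(\<Sum>X\<in>Pow V. w X * f X) = (\<Sum>X\<in>Pow V. \<Sum>v\<in>V. w X * of_bool (v \<in> X) + w X * of_bool (v \<in> bad X))"
  proof (intro sum.cong refl)
    fix X assume "X \<in> Pow V"
    then have "V \<inter> {v. v \<in> X} = X" "V \<inter> {v. v \<in> bad X} = bad X" by (auto simp: bad_def)
    then have "f X = (\<Sum>v\<in>V. of_bool (v \<in> X)) + (\<Sum>v\<in>V. of_bool (v \<in> bad X))"
      using finV by (simp only: f_def sum_of_bool_eq)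
    then show "w X * f X = (\<Sum>v\<in>V. w X * of_bool (v \<in> X) + w X * of_bool (v \<in> bad X))"
      by (simp only: sum.distrib sum_distrib_left distrib_left)
  qed
  also have "\<dots> = (\<Sum>v\<in>V. (\<Sum>X\<in>Pow V. w X * of_bool (v \<in> X)) + (\<Sum>X\<in>Pow V. w X * of_bool (v \<in> bad X)))"
    by (subst sum.swap) (simp add: sum.distrib)
  also have "\<dots> \<le> (\<Sum>v\<in>V. p + 2 powr k * exp (- p * \<delta> / 2))"
    using mem few by (intro sum_mono add_mono) auto
  also have "\<dots> = b" by (simp add: b_def)
  finally have wf: "(\<Sum>X\<in>Pow V. w X * f X) \<le> b" .
  \<comment> \<open>First moment argument: if f exceeded b everywhere, all weights would vanish,
    although they sum to 1.\<close>
  have "\<exists>X\<in>Pow V. f X \<le> b"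
  proof (rule ccontr)
    assume none: "\<not> ?thesis"
    have gt: "f X > b" if "X \<in> Pow V" for X
      using none that by (meson not_le)
    have "(\<Sum>X\<in>Pow V. w X * (f X - b)) = (\<Sum>X\<in>Pow V. w X * f X) - (\<Sum>X\<in>Pow V. w X) * b"
      by (simp only: sum_distrib_right sum_subtractf right_diff_distrib)
    then have "(\<Sum>X\<in>Pow V. w X * (f X - b)) \<le> 0" using wf w1 by simp
    moreover have nn: "0 \<le> w X * (f X - b)" if "X \<in> Pow V" for X
      using gt[OF that] w0[of X] by simp
    ultimately have "(\<Sum>X\<in>Pow V. w X * (f X - b)) = 0"
      by (meson antisym sum_nonneg)
    then have "\<forall>X\<in>Pow V. w X * (f X - b) = 0"
      using finV nn by (subst (asm) sum_nonneg_eq_0_iff) auto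
    then have "w X = 0" if "X \<in> Pow V" for X
      using gt[OF that] that by fastforce
    then show False using w1 by simp
  qed
  then obtain X where X: "X \<subseteq> V" "f X \<le> b" by auto
  have finX: "finite X" using X finV finite_subset by blast
  show ?thesis
  proof (intro exI[of _ "X \<union> bad X"] conjI ballI)
    show "X \<union> bad X \<subseteq> V" using X by (auto simp: bad_def)
    show "real (card (X \<union> bad X)) \<le> real (card V) * (p + 2 powr k * exp (- p * \<delta> / 2))"
      using X(2) card_Un_le[of X "bad X"] unfolding f_def b_def by linarith
    fix v assume v: "v \<in> V - (X \<union> bad X)"
    then have "k \<le> real (card (nbrs E v \<inter> X))" by (auto simp: bad_def)
    also have "\<dots> \<le> real (card (nbrs E v \<inter> (X \<union> bad X)))"
      using finX finV by (intro of_nat_mono card_mono) (auto simp: bad_def)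
    finally show "k \<le> real (card (nbrs E v \<inter> (X \<union> bad X)))" .
  qed
qed

section \<open>Comparison with the estimate of Pauling\<close>

text \<open>For d = 2m, the squares of the Gaussian factor and of the bound in
  \<open>central_binomial_lower\<close> have ratio (m + 1/2) / m = 1 + 1/d, which is at most exp
  (1/d).\<close>

lemma gaussian_le_central_binomial:
  assumes "even d" "0 < d"
  shows "sqrt (2 / (pi * real d)) \<le> real (d choose (d div 2)) / 2 ^ d * exp (1 / (2 * real d))"
proof -
  obtain m where m: "d = 2 * m" using assms by blast
  have m0: "0 < real m" using assms m by simp
  have "2 / (pi * real d) = 1 / (pi * (real m + 1 / 2)) * (1 + 1 / real d)"
  proof -
    have "1 + 1 / real d = (real m + 1 / 2) / real m"
      using m0 by (simp add: m field_simps)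
    moreover have "real m + 1 / 2 \<noteq> 0" using m0 by linarith
    ultimately show ?thesis by (simp add: m)
  qed
  also have "\<dots> \<le> 1 / (pi * (real m + 1 / 2)) * exp (1 / real d)"
    by (intro mult_left_mono) auto
  also have "exp (1 / real d) = (exp (1 / (2 * real d)))\<^sup>2"
    by (simp add: power2_eq_square exp_add[symmetric])
  finally have "sqrt (2 / (pi * real d)) \<le> sqrt (1 / (pi * (real m + 1 / 2)) * (exp (1 / (2 * real d)))\<^sup>2)"
    by (rule real_sqrt_le_mono)
  also have "\<dots> = 1 / sqrt (pi * (real m + 1 / 2)) * exp (1 / (2 * real d))"
    by (subst real_sqrt_mult) (simp add: real_sqrt_divide)
  also have "\<dots> \<le> real ((2 * m) choose m) / 4 ^ m * exp (1 / (2 * real d))"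
    by (intro mult_right_mono central_binomial_lower) auto
  also have "real ((2 * m) choose m) / 4 ^ m = real (d choose (d div 2)) / 2 ^ d"
    by (simp add: m power_mult)
  finally show ?thesis .
qed

text \<open>The number of all orientations times, for each vertex, the probability that a uniform
  orientation balances it, as if these events were independent.\<close>

definition pauling :: "nat \<Rightarrow> nat set set \<Rightarrow> real" where
  "pauling n E = 2 ^ card E * (\<Prod>v\<in>{1..n}. real (degree E v choose (degree E v div 2)) / 2 ^ degree E v)"

lemma pauling_pos: "0 < pauling n E"
  unfolding pauling_def by (intro mult_pos_pos prod_pos) (auto simp: zero_less_binomial_iff)

text \<open>A factor sqrt 2 per end of an edge cancels half of the exponent of 2 in each
  denominator.\<close>

lemma rho_hat_eq_ln_pauling:
  assumes E: "E \<subseteq> nsets {1..n} 2"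
  shows "rho_hat n E = 1 / real n * ln (pauling n E)"
proof -
  have "pauling n E = (\<Prod>v\<in>{1..n}. sqrt 2 ^ degree E v * (real (degree E v choose (degree E v div 2)) / 2 ^ degree E v))"
    unfolding pauling_def two_power_card_edges[OF finite_atLeastAtMost E] by (simp only: prod.distrib)
  also have "ln \<dots> = (\<Sum>v\<in>{1..n}. ln (sqrt 2 ^ degree E v * (real (degree E v choose (degree E v div 2)) / 2 ^ degree E v)))"
    by (intro ln_prod) (auto simp: zero_less_binomial_iff)
  also have "\<dots> = (\<Sum>v\<in>{1..n}. ln (real (degree E v choose (degree E v div 2))) - real (degree E v) / 2 * ln 2)"
  proof (intro sum.cong refl)
    fix v
    have "0 < real (degree E v choose (degree E v div 2))"
      by (simp add: zero_less_binomial_iff)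
    then show "ln (sqrt 2 ^ degree E v * (real (degree E v choose (degree E v div 2)) / 2 ^ degree E v))
        = ln (real (degree E v choose (degree E v div 2))) - real (degree E v) / 2 * ln 2"
      by (simp add: ln_mult ln_div ln_realpow ln_sqrt)
  qed
  finally show ?thesis unfolding rho_hat_def by simp
qed

lemma pauling_le_EO:
  assumes "E \<subseteq> nsets {1..n} 2" "\<And>v. v \<in> {1..n} \<Longrightarrow> even (degree E v)"
  shows "pauling n E \<le> real (EO n E)"
  unfolding pauling_def EO_eq_card[OF assms(1)]
  using assms by (intro card_balanced_ge) auto

text \<open>Here p is the density of the random set, and \<open>p_large\<close> keeps the expected
  fraction of vertices added to it at most 1/D. The summands of the exponent come, in order, from
  the pinned set, the series losses, the outliers, and the exchange of Gaussian for binomial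
  factors.\<close>

lemma EO_le_pauling:
  fixes D \<gamma> k p :: real
  assumes E: "E \<subseteq> nsets {1..n} 2"
    and even: "\<And>v. v \<in> {1..n} \<Longrightarrow> even (degree E v)"
    and deg_le: "\<And>v. v \<in> {1..n} \<Longrightarrow> real (degree E v) \<le> D"
    and deg_ge: "\<And>v. v \<in> {1..n} \<Longrightarrow> \<gamma> * D \<le> real (degree E v)"
    and D: "2 \<le> D" and \<gamma>: "0 < \<gamma>" and k3: "3 \<le> k" and p: "0 \<le> p" "p \<le> 1"
    and k_large: "(2 + 4 / \<gamma>) * ln D + 1 / \<gamma> \<le> k * (ln 2 / 2)"
    and p_large: "k * ln 2 + ln D \<le> p * \<gamma> * D / 2"
  shows "real (EO n E) \<le> pauling n E *
    exp (real n * ((p + 1 / D) * ln D + (1 + ln D) / (\<gamma> * D) + 1 / D + 1 / (2 * \<gamma> * D)))"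
proof -
  have "0 < \<gamma> * D" using D \<gamma> by simp
  obtain S where pinning: "S \<subseteq> {1..n}" "real (card S) \<le> real n * (p + 2 powr k * exp (- p * (\<gamma> * D) / 2))"
      "\<And>v. v \<in> {1..n} - S \<Longrightarrow> k \<le> real (card (nbrs E v \<inter> S))"
    using exists_pinning_set[OF finite_atLeastAtMost E p deg_ge, of k] by auto
  interpret pinned_graph "{1..n}" E S D \<gamma> k
    using E pinning(1,3) deg_le deg_ge D \<gamma> k3 k_large by unfold_locales auto
  have "2 powr k * exp (- p * (\<gamma> * D) / 2) = exp (k * ln 2 - p * \<gamma> * D / 2)"
    by (simp add: powr_def exp_add[symmetric] mult.assoc)
  also have "\<dots> \<le> exp (- ln D)" using p_large by simp
  also have "\<dots> = 1 / D" using D by (simp add: exp_minus inverse_eq_divide)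
  finally have "real n * (p + 2 powr k * exp (- p * (\<gamma> * D) / 2)) \<le> real n * (p + 1 / D)"
    by (intro mult_left_mono) auto
  with pinning(2) have cS: "real (card S) \<le> real n * (p + 1 / D)" by linarith
  define Q where "Q = (\<Prod>v\<in>{1..n}. real (degree E v choose (degree E v div 2)) / 2 ^ degree E v)"
  have Q0: "0 \<le> Q" unfolding Q_def by (intro prod_nonneg) auto
  have "(\<Prod>v\<in>{1..n}. sqrt (2 / (pi * real (degree E v))))
      \<le> (\<Prod>v\<in>{1..n}. real (degree E v choose (degree E v div 2)) / 2 ^ degree E v * exp (1 / (2 * \<gamma> * D)))"
  proof (intro prod_mono conjI)
    fix v assume v: "v \<in> {1..n}"
    have d: "0 < degree E v" using deg_ge[OF v] \<open>0 < \<gamma> * D\<close> by linarith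
    have "sqrt (2 / (pi * real (degree E v)))
        \<le> real (degree E v choose (degree E v div 2)) / 2 ^ degree E v * exp (1 / (2 * real (degree E v)))"
      by (rule gaussian_le_central_binomial[OF even[OF v] d])
    also have "\<dots> \<le> real (degree E v choose (degree E v div 2)) / 2 ^ degree E v * exp (1 / (2 * \<gamma> * D))"
      using deg_ge[OF v] \<open>0 < \<gamma> * D\<close> d
      by (intro mult_left_mono) (auto intro!: divide_left_mono)
    finally show "sqrt (2 / (pi * real (degree E v)))
        \<le> real (degree E v choose (degree E v div 2)) / 2 ^ degree E v * exp (1 / (2 * \<gamma> * D))" .
  qed auto
  also have "\<dots> = Q * exp (real n * (1 / (2 * \<gamma> * D)))"
    unfolding Q_def prod.distrib prod_constant exp_of_nat_mult by simp
  finally have Q: "(\<Prod>v\<in>{1..n}. sqrt (2 / (pi * real (degree E v)))) \<le> Q * exp (real n * (1 / (2 * \<gamma> * D)))" .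
  \<comment> \<open>Dropping the balance conditions on S can only increase the count.\<close>
  have "EO n E \<le> card {F \<in> Pow E. \<forall>v\<in>{1..n} - S. excess E F v = 0}"
    unfolding EO_eq_card[OF E] using finE by (intro card_mono) auto
  then have "real (EO n E) \<le> real (card {F \<in> Pow E. \<forall>v\<in>{1..n} - S. excess E F v = 0})"
    by simp
  also have "\<dots> \<le> 2 ^ card E * ((\<Prod>v\<in>{1..n}. sqrt (2 / (pi * real (degree E v)))) *
         exp (real (card S) * ln D + real n * (1 + ln D) / (\<gamma> * D) + real n / D))"
    using card_balanced_le[OF even] by simp
  also have "\<dots> \<le> 2 ^ card E * ((Q * exp (real n * (1 / (2 * \<gamma> * D)))) *
         exp (real n * (p + 1 / D) * ln D + real n * (1 + ln D) / (\<gamma> * D) + real n / D))"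
  proof (intro mult_left_mono mult_mono Q)
    show "exp (real (card S) * ln D + real n * (1 + ln D) / (\<gamma> * D) + real n / D)
       \<le> exp (real n * (p + 1 / D) * ln D + real n * (1 + ln D) / (\<gamma> * D) + real n / D)"
      using cS D by (simp add: mult_right_mono)
  qed (use Q0 in auto)
  also have "\<dots> = pauling n E *
      exp (real n * ((p + 1 / D) * ln D + (1 + ln D) / (\<gamma> * D) + 1 / D + 1 / (2 * \<gamma> * D)))"
    unfolding pauling_def Q_def[symmetric]
    by (simp only: mult.assoc exp_add[symmetric]) (simp add: algebra_simps)
  finally show ?thesis .
qed

text \<open>\<open>EO_le_pauling\<close> is applied with \<open>k = K * ln D\<close> and
  \<open>p = A * ln D / D\<close>. K meets \<open>k_large\<close>, as \<open>1 \<le> ln D\<close>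
  absorbs \<open>1 / \<gamma>\<close>; A makes \<open>p_large\<close> an equality; and
  \<open>A * ln D \<le> D\<close> says that p is at most 1.\<close>

lemma abs_rho_minus_rho_hat_le:
  fixes D \<gamma> :: real
  assumes n: "0 < n" and E: "E \<subseteq> nsets {1..n} 2"
    and even: "\<And>v. v \<in> {1..n} \<Longrightarrow> even (degree E v)"
    and deg_le: "\<And>v. v \<in> {1..n} \<Longrightarrow> real (degree E v) \<le> D"
    and deg_ge: "\<And>v. v \<in> {1..n} \<Longrightarrow> \<gamma> * D \<le> real (degree E v)"
    and \<gamma>: "0 < \<gamma>"
  defines "K \<equiv> (2 + 5 / \<gamma>) * (2 / ln 2)"
  defines "A \<equiv> 2 * (K * ln 2 + 1) / \<gamma>"
  assumes D: "2 \<le> D" "1 \<le> ln D" "A * ln D \<le> D"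
  shows "\<bar>rho n E - rho_hat n E\<bar> \<le> (A + 2 + 3 / \<gamma>) * ((ln D)\<^sup>2 / D)"
proof -
  define L where "L = ln D"
  have L: "1 \<le> L" "0 < D" using D by (auto simp: L_def)
  define err where "err = (A * L / D + 1 / D) * L + (1 + L) / (\<gamma> * D) + 1 / D + 1 / (2 * \<gamma> * D)"
  have ln2: "0 < ln (2::real)" "ln (2::real) \<le> 1" using ln_2_less_1 by auto
  have "4 \<le> K"
  proof -
    have "2 * 2 \<le> (2 + 5 / \<gamma>) * (2 / ln 2)"
      using ln2 \<gamma> by (intro mult_mono) (auto simp: field_simps)
    then show ?thesis by (simp add: K_def)
  qed
  have A0: "0 \<le> A" using \<open>4 \<le> K\<close> ln2 \<gamma> by (auto simp: A_def)
  have "real (EO n E) \<le> pauling n E * exp (real n * err)"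
    unfolding err_def L_def
  proof (rule EO_le_pauling[where k = "K * ln D"])
    show "3 \<le> K * ln D" using mult_mono[OF \<open>4 \<le> K\<close> D(2)] \<open>4 \<le> K\<close> by simp
    show "0 \<le> A * ln D / D" "A * ln D / D \<le> 1" using A0 D L by auto
    have "1 / \<gamma> \<le> ln D / \<gamma>" using D(2) \<gamma> by (intro divide_right_mono) auto
    moreover have "(2 + 5 / \<gamma>) * ln D = (2 + 4 / \<gamma>) * ln D + ln D / \<gamma>"
      using \<gamma> by (simp add: field_simps)
    ultimately have "(2 + 4 / \<gamma>) * ln D + 1 / \<gamma> \<le> (2 + 5 / \<gamma>) * ln D"
      by linarith
    also have "\<dots> = K * ln D * (ln 2 / 2)" using ln2 by (simp add: K_def)
    finally show "(2 + 4 / \<gamma>) * ln D + 1 / \<gamma> \<le> K * ln D * (ln 2 / 2)" .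
    have "A * ln D / D * \<gamma> * D / 2 = A * \<gamma> / 2 * ln D" using L by simp
    also have "A * \<gamma> / 2 = K * ln 2 + 1" using \<gamma> by (simp add: A_def)
    finally show "K * ln D * ln 2 + ln D \<le> A * ln D / D * \<gamma> * D / 2"
      by (simp add: algebra_simps)
  qed (use assms in auto)
  moreover have lower: "pauling n E \<le> real (EO n E)"
    by (rule pauling_le_EO[OF E even])
  moreover note pauling_pos[of n E]
  ultimately have EO0: "0 < real (EO n E)" and "ln (real (EO n E)) \<le> ln (pauling n E * exp (real n * err))"
    by (linarith, subst ln_le_cancel_iff) auto
  then have upper: "ln (real (EO n E)) \<le> ln (pauling n E) + real n * err"
    using pauling_pos[of n E] by (simp add: ln_mult)
  have lower': "ln (pauling n E) \<le> ln (real (EO n E))"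
    using lower pauling_pos[of n E] EO0 by simp
  have "\<bar>rho n E - rho_hat n E\<bar> = 1 / real n * (ln (real (EO n E)) - ln (pauling n E))"
    using lower' unfolding rho_def rho_hat_eq_ln_pauling[OF E]
    by (simp add: right_diff_distrib[symmetric] divide_right_mono diff_divide_distrib)
  also have "\<dots> \<le> 1 / real n * (real n * err)"
    using upper by (intro mult_left_mono) auto
  also have "\<dots> = err" using n by simp
  also have "err = (A * L\<^sup>2 + L + (1 + L) / \<gamma> + 1 + 1 / (2 * \<gamma>)) / D"
    using L \<gamma> by (simp add: err_def power2_eq_square field_simps)
  \<comment> \<open>Since L is at least 1, all lower powers of it are absorbed into
    \<open>L\<^sup>2\<close>.\<close>
  also have "\<dots> \<le> (A * L\<^sup>2 + L\<^sup>2 + (L\<^sup>2 + L\<^sup>2) / \<gamma> + L\<^sup>2 + L\<^sup>2 / \<gamma>) / D"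
  proof -
    have "L \<le> L\<^sup>2" "1 \<le> L\<^sup>2" using L by (auto simp: power2_eq_square intro: mult_mono[of 1 L 1 L, simplified])
    moreover from this have "(1 + L) / \<gamma> \<le> (L\<^sup>2 + L\<^sup>2) / \<gamma>"
      using \<gamma> by (intro divide_right_mono) linarith+
    moreover have "1 / 2 / \<gamma> \<le> L\<^sup>2 / \<gamma>"
      using \<gamma> \<open>1 \<le> L\<^sup>2\<close> by (intro divide_right_mono) linarith+
    then have "1 / (2 * \<gamma>) \<le> L\<^sup>2 / \<gamma>" by simp
    ultimately show ?thesis
      using L by (intro divide_right_mono) linarith+
  qed
  also have "\<dots> = (A + 2 + 3 / \<gamma>) * ((ln D)\<^sup>2 / D)"
    using L \<gamma> by (simp add: L_def[symmetric] field_simps)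
  finally show ?thesis .
qed

theorem theorem4p4:
  fixes d :: "nat \<Rightarrow> nat \<Rightarrow> nat" and \<gamma> :: real
  assumes "eventually (\<lambda>n. graphical n (d n)) sequentially"
    and "eventually (\<lambda>n. \<forall>i\<in>{1..n}. 0 < d n i \<and> even (d n i)) sequentially"
    and "(\<lambda>n. ln (real n) ^ 8) \<in> o[sequentially](\<lambda>n. real (d_max n (d n)))"
    and "\<gamma> > 0"
    and "eventually (\<lambda>n. real (d_min n (d n)) \<ge> \<gamma> * real (d_max n (d n))) sequentially"
  shows "\<exists>c>0. \<exists>C>0. eventually (\<lambda>n.
           measure_pmf.prob (random_graph n (d n))
             {G. \<bar>rho n G - rho_hat n G\<bar>
                   \<le> C * (ln (real (d_max n (d n))) ^ 2 / real (d_max n (d n)))}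
           \<ge> 1 - exp (- c * real (d_max n (d n)) ^ 2)) sequentially"
proof -
  define D where "D n = real (d_max n (d n))" for n
  define K where "K = (2 + 5 / \<gamma>) * (2 / ln 2)"
  define A where "A = 2 * (K * ln 2 + 1) / \<gamma>"
  have A0: "0 < A + 2 + 3 / \<gamma>"
    using assms(4) by (auto simp: A_def K_def intro!: add_nonneg_pos add_pos_pos divide_pos_pos mult_pos_pos)
  \<comment> \<open>The growth hypothesis makes the maximum degree tend to infinity, which supplies
    the size conditions on D.\<close>
  have D_top: "filterlim D at_top sequentially"
  proof (rule filterlim_at_top_mono)
    show "filterlim (\<lambda>n. ln (real n) ^ 8) at_top sequentially"
      by (intro filterlim_pow_at_top filterlim_compose[OF ln_at_top filterlim_real_sequentially]) simp
    have "eventually (\<lambda>n. norm (ln (real n) ^ 8) \<le> 1 * norm (D n)) sequentially"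
      using assms(3) unfolding D_def by (rule landau_o.smallD) simp
    then show "eventually (\<lambda>n. ln (real n) ^ 8 \<le> D n) sequentially"
      by eventually_elim (simp add: D_def)
  qed
  have "eventually (\<lambda>x::real. 2 \<le> x) at_top"
    by (rule eventually_ge_at_top)
  moreover have "eventually (\<lambda>x::real. 1 \<le> ln x) at_top"
    using ln_at_top by (simp add: filterlim_at_top)
  moreover have "eventually (\<lambda>x::real. A * ln x \<le> x) at_top"
  proof -
    have "((\<lambda>x. A * (ln x / x)) \<longlongrightarrow> A * 0) at_top"
      by (intro tendsto_mult tendsto_const ln_x_over_x_tendsto_0)
    then have "eventually (\<lambda>x. A * (ln x / x) < 1) at_top"
      by (rule order_tendstoD) simp
    then show ?thesis
      using eventually_gt_at_top[of 0] by eventually_elim (simp add: field_simps)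
  qed
  ultimately have "eventually (\<lambda>x::real. 2 \<le> x \<and> 1 \<le> ln x \<and> A * ln x \<le> x) at_top"
    by eventually_elim simp
  then have "eventually (\<lambda>n. 2 \<le> D n \<and> 1 \<le> ln (D n) \<and> A * ln (D n) \<le> D n) sequentially"
    using D_top by (rule eventually_compose_filterlim)
  then have "eventually (\<lambda>n. measure_pmf.prob (random_graph n (d n))
      {G. \<bar>rho n G - rho_hat n G\<bar> \<le> (A + 2 + 3 / \<gamma>) * ((ln (D n))\<^sup>2 / D n)}
        \<ge> 1 - exp (- 1 * (D n)\<^sup>2)) sequentially"
    using assms(1,2,5) eventually_gt_at_top[of 0]
  proof eventually_elim
    case (elim n)
    \<comment> \<open>There are no exceptional graphs: the bound holds on the whole support, so the
      event has probability 1.\<close>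
    have "\<bar>rho n G - rho_hat n G\<bar> \<le> (A + 2 + 3 / \<gamma>) * ((ln (D n))\<^sup>2 / D n)"
      if "G \<in> set_pmf (random_graph n (d n))" for G
    proof -
      have G: "G \<in> graphs_with_degrees n (d n)"
        using that elim(2) finite_graphs_with_degrees[of n "d n"]
        by (simp add: random_graph_def graphical_def)
      then have deg: "degree G v = d n v" if "v \<in> {1..n}" for v
        using that by (simp add: graphs_with_degrees_def)
      show ?thesis
        unfolding A_def K_def
      proof (rule abs_rho_minus_rho_hat_le)
        show "G \<subseteq> nsets {1..n} 2" using G by (simp add: graphs_with_degrees_def)
        fix v assume v: "v \<in> {1..n}"
        show "even (degree G v)" using deg[OF v] elim(3) v by simp
        show "real (degree G v) \<le> D n"
          unfolding deg[OF v] D_def d_max_def using v by (intro of_nat_mono Max_ge) auto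
        have "d_min n (d n) \<le> d n v"
          unfolding d_min_def using v by (intro Min_le) auto
        then show "\<gamma> * D n \<le> real (degree G v)"
          using elim(4) unfolding deg[OF v] D_def by linarith
      qed (use elim assms(4) in \<open>auto simp: A_def K_def\<close>)
    qed
    then have "measure_pmf.prob (random_graph n (d n))
        {G. \<bar>rho n G - rho_hat n G\<bar> \<le> (A + 2 + 3 / \<gamma>) * ((ln (D n))\<^sup>2 / D n)} = 1"
      by (subst measure_pmf.prob_eq_1) (auto simp: AE_measure_pmf_iff)
    then show ?case by simp
  qed
  then show ?thesis
    unfolding D_def using A0
    \<comment> \<open>As the event is eventually certain, any positive c would serve; 1 is
      taken.\<close>
    by (intro exI[of _ 1] exI[of _ "A + 2 + 3 / \<gamma>"] conjI) auto
qed

end
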